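(* The hypotheses $\mathbf{Reg}$, $\mathbf{Tot}$, $\mathbf{Un}_h$ and $\mathbf{Co}$ are insufficient to uniquely determine a (hyperfinite) probability model of chance for the spinner; that is, there exist two distinct hyperfinite sets $\Omega,\Omega'\subseteq{}^{\ast}[0,1)$, each with standard part $[0,1]$, such that the hyperfinite probability measures $P_{\Omega}$ and $P_{\Omega'}$ both satisfy $\mathbf{Reg}$, $\mathbf{Tot}$, $\mathbf{Un}_h$ and $\mathbf{Co}$.
   Context: Work in ZFC, with Robinson's nonstandard analysis: ${}^{\ast}\mathbb{R}$ is a hyperreal field arising from a nonstandard extension $A\mapsto{}^{\ast}A$ of the superstructure over $\mathbb{R}$ that satisfies the transfer principle and is sufficiently saturated (for instance $(2^{2^{\aleph_0}})^{+}$-saturated). A set is internal if it is an element of ${}^{\ast}Z$ for some $Z$ in the superstructure over $\mathbb{R}$; a hyperfinite set is an internal set admitting an internal bijection with $\{1,\dots,H\}$ for some $H\in{}^{\ast}\mathbb{N}$, and then $|\cdot|$ denotes its internal cardinality $H$. For a limited $x\in{}^{\ast}\mathbb{R}$, $\mathrm{st}\,x$ is the real number infinitely close to $x$; for a set $X$ of limited elements, $\mathrm{st}\,X=\{\mathrm{st}\,x:x\in X\}$. Write $x\approx y$ when $x-y$ is infinitesimal. $L$ denotes Lebesgue measure on $[0,1)$. The "spinner" is a uniform process with outcomes in $[0,1)$. A hyperfinite model of it is given by a hyperfinite set $\Omega\subseteq{}^{\ast}[0,1)$ with $\mathrm{st}\,\Omega=[0,1]$, together with $P_{\Omega}(A)=\frac{|A|}{|\Omega|}$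 for every internal $A\subseteq\Omega$. Hypotheses: - $\mathbf{Reg}$: every possible outcome has positive chance, i.e. $P_{\Omega}(A)>0$ for every nonempty internal $A\subseteq\Omega$. - $\mathbf{Tot}$: every set outcome is assigned a probability; for hyperfinite models this means every internal subset of $\Omega$ is assigned a probability (and hence every $A\subseteq[0,1)$ is assigned the value $P_{\Omega}({}^{\ast}A\cap\Omega)$). - $\mathbf{Un}_h$: if two internal subsets of $\Omega$ have the same (internal) number of points, then they have the same chance. - $\mathbf{Co}$: $P_{\Omega}({}^{\ast}A\cap\Omega)\approx L(A)$ for each Lebesgue measurable set $A\subseteq[0,1)$. *)

theory Defs
  imports "HOL-Analysis.Analysis" "HOL-Library.Equipollence"
begin

section \<open>Superstructures\<close>

text \<open>
  The superstructure over a set \<open>X\<close> of atoms is \<open>V(X) = (\<Union>n. V\<^sub>n)\<close> with \<open>V\<^sub>0 = X\<close> and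
  \<open>V\<^sub>n\<^sub>+\<^sub>1 = V\<^sub>n \<union> Pow V\<^sub>n\<close>. All finite types over the reals occur in it, so it cannot be
  a type built from \<^typ>\<open>real\<close>; it is given instead as a type \<open>'v\<close> together with the embedding
  of the atoms and the map from a set in the superstructure to its elements. The predicate
  \<open>superstructure\<close> below determines this data up to a unique isomorphism over the atoms.
\<close>

record ('a, 'v) superstr =
  atom :: "'a \<Rightarrow> 'v"
  elts :: "'v \<Rightarrow> 'v set"

primrec level :: "('a, 'v) superstr \<Rightarrow> nat \<Rightarrow> 'v set" where
  "level S 0 = range (atom S)"
| "level S (Suc n) = level S n \<union> {x. x \<notin> range (atom S) \<and> elts S x \<subseteq> level S n}"

definition superstructure :: "('a, 'v) superstr \<Rightarrow> bool" where
  "superstructure S \<longleftrightarrow>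
     inj (atom S) \<and>
     (\<forall>a. elts S (atom S a) = {}) \<and>
     inj_on (elts S) (- range (atom S)) \<and>
     (\<forall>n. \<forall>A \<subseteq> level S n. \<exists>x. x \<notin> range (atom S) \<and> elts S x = A) \<and>
     (\<forall>x. \<exists>n. x \<in> level S n)"

text \<open>Objects of the superstructure; \<open>mkset S A\<close> is meaningful if \<open>A \<subseteq> level S n\<close> for some \<open>n\<close>.\<close>

definition mkset :: "('a, 'v) superstr \<Rightarrow> 'v set \<Rightarrow> 'v" where
  "mkset S A = (THE x. x \<notin> range (atom S) \<and> elts S x = A)"

definition opair :: "('a, 'v) superstr \<Rightarrow> 'v \<Rightarrow> 'v \<Rightarrow> 'v" where
  "opair S x y = mkset S {mkset S {x}, mkset S {x, y}}"

definition obj1 :: "('a, 'v) superstr \<Rightarrow> 'a set \<Rightarrow> 'v" where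
  "obj1 S A = mkset S (atom S ` A)"

definition obj2 :: "('a, 'v) superstr \<Rightarrow> ('a \<times> 'a) set \<Rightarrow> 'v" where
  "obj2 S R = mkset S ((\<lambda>(x, y). opair S (atom S x) (atom S y)) ` R)"

definition obj3 :: "('a, 'v) superstr \<Rightarrow> ('a \<times> 'a \<times> 'a) set \<Rightarrow> 'v" where
  "obj3 S R = mkset S ((\<lambda>(x, y, z). opair S (opair S (atom S x) (atom S y)) (atom S z)) ` R)"

section \<open>Nonstandard extensions\<close>

text \<open>
  Bounded formulas of the language of set theory; \<open>BAll i j \<phi>\<close> stands for
  \<open>\<forall>x\<^sub>i \<in> x\<^sub>j. \<phi>\<close>. Parameters are values of free variables.
\<close>

datatype bformula =
    Equal nat nat
  | Mem nat nat
  | Neg bformula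
  | Conj bformula bformula
  | BAll nat nat bformula

primrec sat :: "('a, 'v) superstr \<Rightarrow> (nat \<Rightarrow> 'v) \<Rightarrow> bformula \<Rightarrow> bool" where
  "sat S e (Equal i j) \<longleftrightarrow> e i = e j"
| "sat S e (Mem i j) \<longleftrightarrow> e i \<in> elts S (e j)"
| "sat S e (Neg \<phi>) \<longleftrightarrow> \<not> sat S e \<phi>"
| "sat S e (Conj \<phi> \<psi>) \<longleftrightarrow> sat S e \<phi> \<and> sat S e \<psi>"
| "sat S e (BAll i j \<phi>) \<longleftrightarrow> (\<forall>y \<in> elts S (e j). sat S (e(i := y)) \<phi>)"

text \<open>A map \<open>star\<close> from the superstructure over the reals to the one over the hyperreals \<open>'h\<close>.\<close>

record ('h, 'v, 'w) nsext =
  std :: "(real, 'v) superstr"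
  nst :: "('h, 'w) superstr"
  star :: "'v \<Rightarrow> 'w"

definition transfer_principle :: "('h, 'v, 'w) nsext \<Rightarrow> bool" where
  "transfer_principle N \<longleftrightarrow>
     (\<forall>\<phi> e. sat (std N) e \<phi> \<longleftrightarrow> sat (nst N) (\<lambda>i. star N (e i)) \<phi>)"

text \<open>
  The last four conditions say that \<open>'h\<close> is \<open>*\<real>\<close>, and that its ordered field structure
  consists of the extensions of addition, multiplication and order of the reals.
\<close>

definition nonstandard_extension :: "('h :: linordered_field, 'v, 'w) nsext \<Rightarrow> bool" where
  "nonstandard_extension N \<longleftrightarrow>
     superstructure (std N) \<and> superstructure (nst N) \<and> transfer_principle N \<and>
     star N (obj1 (std N) UNIV) = obj1 (nst N) UNIV \<and>
     star N (obj3 (std N) {(x, y, z). z = x + y}) = obj3 (nst N) {(x, y, z). z = x + y} \<and>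
     star N (obj3 (std N) {(x, y, z). z = x * y}) = obj3 (nst N) {(x, y, z). z = x * y} \<and>
     star N (obj2 (std N) {(x, y). x < y}) = obj2 (nst N) {(x, y). x < y}"

definition internal :: "('h, 'v, 'w) nsext \<Rightarrow> 'w \<Rightarrow> bool" where
  "internal N x \<longleftrightarrow> (\<exists>Z. x \<in> elts (nst N) (star N Z))"

text \<open>
  \<open>\<kappa>\<^sup>+\<close>-saturation for \<open>\<kappa> = 2\<close> to the \<open>2\<close> to the \<open>\<aleph>\<^sub>0\<close>, the cardinality of the power set
  of the reals: the families considered have fewer than \<open>\<kappa>\<^sup>+\<close>, i.e. at most \<open>\<kappa>\<close>, members.
\<close>

definition saturated :: "('h, 'v, 'w) nsext \<Rightarrow> bool" where
  "saturated N \<longleftrightarrow>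
     (\<forall>F :: 'w set.
        F \<lesssim> Pow (UNIV :: real set) \<longrightarrow>
        (\<forall>X\<in>F. internal N X \<and> X \<notin> range (atom (nst N))) \<longrightarrow>
        (\<forall>G \<subseteq> F. finite G \<longrightarrow> (\<Inter>X\<in>G. elts (nst N) X) \<noteq> {}) \<longrightarrow>
        (\<Inter>X\<in>F. elts (nst N) X) \<noteq> {})"

section \<open>Hyperreals\<close>

definition hyper :: "('h, 'v, 'w) nsext \<Rightarrow> real \<Rightarrow> 'h" where
  "hyper N r = (THE h. atom (nst N) h = star N (atom (std N) r))"

definition star_set :: "('h, 'v, 'w) nsext \<Rightarrow> real set \<Rightarrow> 'h set" where
  "star_set N A = {h. atom (nst N) h \<in> elts (nst N) (star N (obj1 (std N) A))}"

definition infinitesimal :: "('h :: linordered_field, 'v, 'w) nsext \<Rightarrow> 'h \<Rightarrow> bool" where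
  "infinitesimal N x \<longleftrightarrow> (\<forall>r>0. \<bar>x\<bar> < hyper N r)"

definition inf_close :: "('h :: linordered_field, 'v, 'w) nsext \<Rightarrow> 'h \<Rightarrow> 'h \<Rightarrow> bool" where
  "inf_close N x y \<longleftrightarrow> infinitesimal N (x - y)"

definition st :: "('h :: linordered_field, 'v, 'w) nsext \<Rightarrow> 'h \<Rightarrow> real" where
  "st N x = (THE r. inf_close N x (hyper N r))"

section \<open>Hyperfinite sets of hyperreals\<close>

definition internal_set :: "('h, 'v, 'w) nsext \<Rightarrow> 'h set \<Rightarrow> bool" where
  "internal_set N A \<longleftrightarrow> internal N (obj1 (nst N) A)"

definition internal_bij_betw ::
  "('h, 'v, 'w) nsext \<Rightarrow> ('h \<Rightarrow> 'h) \<Rightarrow> 'h set \<Rightarrow> 'h set \<Rightarrow> bool" where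
  "internal_bij_betw N f A B \<longleftrightarrow>
     bij_betw f A B \<and> internal N (obj2 (nst N) {(x, f x) | x. x \<in> A})"

definition has_hcard :: "('h :: linordered_field, 'v, 'w) nsext \<Rightarrow> 'h set \<Rightarrow> 'h \<Rightarrow> bool" where
  "has_hcard N A H \<longleftrightarrow>
     internal_set N A \<and> H \<in> star_set N \<nat> \<and>
     (\<exists>f. internal_bij_betw N f A {k \<in> star_set N \<nat>. 1 \<le> k \<and> k \<le> H})"

definition hyperfinite :: "('h :: linordered_field, 'v, 'w) nsext \<Rightarrow> 'h set \<Rightarrow> bool" where
  "hyperfinite N A \<longleftrightarrow> (\<exists>H. has_hcard N A H)"

definition hcard :: "('h :: linordered_field, 'v, 'w) nsext \<Rightarrow> 'h set \<Rightarrow> 'h" where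
  "hcard N A = (THE H. has_hcard N A H)"

section \<open>Hyperfinite models of the spinner\<close>

text \<open>
  A chance function is partial (\<open>None\<close> means that no probability is assigned). In
  particular \<open>P\<^sub>\<Omega>\<close> is only defined at internal subsets of \<open>\<Omega>\<close> that have an internal cardinality.
\<close>

definition hprob ::
  "('h :: linordered_field, 'v, 'w) nsext \<Rightarrow> 'h set \<Rightarrow> 'h set \<Rightarrow> 'h option" where
  "hprob N \<Omega> A =
     (if A \<subseteq> \<Omega> \<and> hyperfinite N A then Some (hcard N A / hcard N \<Omega>) else None)"

definition spinner_sample_space :: "('h :: linordered_field, 'v, 'w) nsext \<Rightarrow> 'h set \<Rightarrow> bool" where
  "spinner_sample_space N \<Omega> \<longleftrightarrow>
     hyperfinite N \<Omega> \<and> \<Omega> \<subseteq> star_set N {0..<1} \<and> st N ` \<Omega> = {0..1}"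

definition Reg ::
  "('h :: linordered_field, 'v, 'w) nsext \<Rightarrow> 'h set \<Rightarrow> ('h set \<Rightarrow> 'h option) \<Rightarrow> bool" where
  "Reg N \<Omega> P \<longleftrightarrow>
     (\<forall>A \<subseteq> \<Omega>. internal_set N A \<and> A \<noteq> {} \<longrightarrow> (\<exists>p. P A = Some p \<and> p > 0))"

definition Tot ::
  "('h :: linordered_field, 'v, 'w) nsext \<Rightarrow> 'h set \<Rightarrow> ('h set \<Rightarrow> 'h option) \<Rightarrow> bool" where
  "Tot N \<Omega> P \<longleftrightarrow>
     (\<forall>A \<subseteq> \<Omega>. internal_set N A \<longrightarrow> (\<exists>p. P A = Some p \<and> 0 \<le> p \<and> p \<le> 1)) \<and>
     (\<forall>A \<subseteq> {0..<1}. \<exists>p. P (star_set N A \<inter> \<Omega>) = Some p \<and> 0 \<le> p \<and> p \<le> 1)"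

definition Un_h ::
  "('h :: linordered_field, 'v, 'w) nsext \<Rightarrow> 'h set \<Rightarrow> ('h set \<Rightarrow> 'h option) \<Rightarrow> bool" where
  "Un_h N \<Omega> P \<longleftrightarrow>
     (\<forall>A \<subseteq> \<Omega>. \<forall>B \<subseteq> \<Omega>. internal_set N A \<and> internal_set N B \<and>
        (\<exists>H. has_hcard N A H \<and> has_hcard N B H) \<longrightarrow> P A = P B)"

definition Co ::
  "('h :: linordered_field, 'v, 'w) nsext \<Rightarrow> 'h set \<Rightarrow> ('h set \<Rightarrow> 'h option) \<Rightarrow> bool" where
  "Co N \<Omega> P \<longleftrightarrow>
     (\<forall>A \<subseteq> {0..<1}. A \<in> sets lebesgue \<longrightarrow>
        (\<exists>p. P (star_set N A \<inter> \<Omega>) = Some p \<and> inf_close N p (hyper N (measure lebesgue A))))"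

end

theory Submission
  imports Defs
begin

text \<open>
  Finite sets of reals are coded by reals, so that hyperfinite sets become the sections \<open>hfin N h\<close> of
  the extension of one binary relation on the reals, and internal subsets, intersections with
  standard sets and internal cardinalities all transfer from first-order facts about codes. Given
  finitely many measurable subsets of \<open>[0,1)\<close>, a finite set with about \<open>M * \<mu>\<close> points in each atom of
  measure \<open>\<mu>\<close> of the algebra they generate approximates Lebesgue measure on all of them, and it may
  be chosen to contain \<open>0\<close> or to avoid it. Saturation yields codes of hyperfinite sets that
  approximate every measurable set up to infinitesimals, one containing \<open>0\<close> and one not. A second
  use of saturation, on shrinking neighbourhoods of a point of \<open>[0,1]\<close>, shows that the standard part
  is all of \<open>[0,1]\<close>.
\<close>

section \<open>Superstructures and bounded formulas\<close>

locale superstr =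
  fixes S :: "('a, 'v) superstr"
  assumes superstructure: "superstructure S"
begin

lemma inj_atom: "inj (atom S)"
  using superstructure by (simp add: superstructure_def)

lemma atom_eq_iff [simp]: "atom S a = atom S b \<longleftrightarrow> a = b"
  using inj_atom by (auto dest: injD)

lemma elts_atom [simp]: "elts S (atom S a) = {}"
  using superstructure by (simp add: superstructure_def)

lemma elts_nonempty_not_atom: "x \<in> elts S y \<Longrightarrow> y \<notin> range (atom S)"
  by auto

lemma elts_inject:
  "\<lbrakk>x \<notin> range (atom S); y \<notin> range (atom S); elts S x = elts S y\<rbrakk> \<Longrightarrow> x = y"
  using superstructure unfolding superstructure_def inj_on_def by blast

lemma level_mono: "m \<le> n \<Longrightarrow> level S m \<subseteq> level S n"
  by (rule lift_Suc_mono_le) auto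

lemma in_level: "\<exists>n. x \<in> level S n"
  using superstructure by (simp add: superstructure_def)

lemma ex_level_pair: "\<exists>n. {x, y} \<subseteq> level S n"
proof -
  obtain m n where "x \<in> level S m" "y \<in> level S n"
    using in_level by meson
  then have "x \<in> level S (max m n)" "y \<in> level S (max m n)"
    using level_mono[of m "max m n"] level_mono[of n "max m n"] by auto
  then show ?thesis by auto
qed

text \<open>The bound by a level gives existence, and injectivity of \<open>elts\<close> off the
  atoms gives uniqueness, so the definite description in \<open>mkset\<close> denotes.\<close>

lemma mkset:
  assumes "A \<subseteq> level S n"
  shows mkset_not_atom: "mkset S A \<notin> range (atom S)"
    and elts_mkset: "elts S (mkset S A) = A"
proof -
  obtain x where x: "x \<notin> range (atom S) \<and> elts S x = A"
    using superstructure assms unfolding superstructure_def by blast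
  have "mkset S A \<notin> range (atom S) \<and> elts S (mkset S A) = A"
    unfolding mkset_def using x by (rule theI) (metis x elts_inject)
  then show "mkset S A \<notin> range (atom S)" "elts S (mkset S A) = A" by auto
qed

lemma mkset_pair:
  shows mkset_pair_not_atom: "mkset S {x, y} \<notin> range (atom S)"
    and elts_mkset_pair [simp]: "elts S (mkset S {x, y}) = {x, y}"
  using mkset ex_level_pair by meson+

lemma mkset_singleton:
  shows mkset_singleton_not_atom: "mkset S {x} \<notin> range (atom S)"
    and elts_mkset_singleton [simp]: "elts S (mkset S {x}) = {x}"
  using mkset_pair[of x x] by auto

lemma elts_opair [simp]: "elts S (opair S x y) = {mkset S {x}, mkset S {x, y}}"
  by (simp add: opair_def)

lemma opair_not_atom: "opair S x y \<notin> range (atom S)"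
  unfolding opair_def by (rule mkset_pair_not_atom)

text \<open>Atoms and the empty set share the same \<open>elts\<close>, so elements alone do not
  identify an object; a pair is nonempty, which rules out atoms. This lets formulas recognise pairs
  by their elements.\<close>

lemma eq_pair_iff: "u = mkset S {x, y} \<longleftrightarrow> elts S u = {x, y}"
  using elts_inject[of u "mkset S {x, y}"] mkset_pair_not_atom
  by (metis elts_mkset_pair elts_nonempty_not_atom insertI1)

lemma eq_opair_iff:
  "z = opair S x y \<longleftrightarrow> elts S z = {mkset S {x}, mkset S {x, y}}"
  unfolding opair_def by (rule eq_pair_iff)

lemma opair_eq_iff [simp]: "opair S x y = opair S x' y' \<longleftrightarrow> x = x' \<and> y = y'"
proof
  assume "opair S x y = opair S x' y'"
  then have "{mkset S {x}, mkset S {x, y}} = {mkset S {x'}, mkset S {x', y'}}"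
    by (metis elts_opair)
  \<comment> \<open>Replacing each inner set by its elements moves the equation to sets of sets in
    HOL, where the Kuratowski argument applies.\<close>
  then have "elts S ` {mkset S {x}, mkset S {x, y}} = elts S ` {mkset S {x'}, mkset S {x', y'}}"
    by simp
  then have "{{x}, {x, y}} = {{x'}, {x', y'}}" by simp
  then show "x = x' \<and> y = y'" by (metis doubleton_eq_iff singleton_insert_inj_eq)
qed simp

lemma opair_level:
  assumes "x \<in> level S n" "y \<in> level S n"
  shows "opair S x y \<in> level S (n + 2)"
  using assms mkset_pair_not_atom[of x y] mkset_singleton_not_atom[of x] opair_not_atom[of x y]
  by (auto simp: numeral_2_eq_2)

lemma atom_in_level: "atom S a \<in> level S n"
  using level_mono[of 0 n] by auto

lemma obj1_subset: "atom S ` A \<subseteq> level S 0"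
  by auto

lemma opair_atom_level: "opair S (atom S x) (atom S y) \<in> level S 2"
  using opair_level[of "atom S x" 0 "atom S y"] by (simp add: numeral_2_eq_2)

lemma obj2_subset: "(\<lambda>(x, y). opair S (atom S x) (atom S y)) ` R \<subseteq> level S 2"
  using opair_atom_level by auto

lemma obj3_subset:
  "(\<lambda>(x, y, z). opair S (opair S (atom S x) (atom S y)) (atom S z)) ` R \<subseteq> level S 4"
  using opair_level[OF opair_atom_level atom_in_level] by auto

lemma elts_obj1 [simp]: "elts S (obj1 S A) = atom S ` A"
  and obj1_not_atom: "obj1 S A \<notin> range (atom S)"
  unfolding obj1_def using mkset[OF obj1_subset] by auto

lemma elts_obj2: "elts S (obj2 S R) = (\<lambda>(x, y). opair S (atom S x) (atom S y)) ` R"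
  and obj2_not_atom: "obj2 S R \<notin> range (atom S)"
  unfolding obj2_def using mkset[OF obj2_subset] by auto

lemma elts_obj3:
  "elts S (obj3 S R) = (\<lambda>(x, y, z). opair S (opair S (atom S x) (atom S y)) (atom S z)) ` R"
  unfolding obj3_def using mkset[OF obj3_subset] by auto

lemma opair_in_obj2 [simp]:
  "opair S (atom S x) (atom S y) \<in> elts S (obj2 S R) \<longleftrightarrow> (x, y) \<in> R"
  by (force simp: elts_obj2)

lemma opair_in_obj3 [simp]:
  "opair S (opair S (atom S x) (atom S y)) (atom S z) \<in> elts S (obj3 S R) \<longleftrightarrow> (x, y, z) \<in> R"
  by (force simp: elts_obj3)

lemma obj1_in_level: "obj1 S A \<in> level S 1"
  using obj1_not_atom[of A] by auto

lemma obj2_in_level: "obj2 S R \<in> level S 3"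
  using obj2_not_atom[of R] obj2_subset[of R]
  by (simp add: elts_obj2[symmetric] numeral_3_eq_3 numeral_2_eq_2)

end

section \<open>Derived connectives and bounded formulas for pairs and triples\<close>

definition Disj :: "bformula \<Rightarrow> bformula \<Rightarrow> bformula" where
  "Disj \<phi> \<psi> = Neg (Conj (Neg \<phi>) (Neg \<psi>))"

definition Imp :: "bformula \<Rightarrow> bformula \<Rightarrow> bformula" where
  "Imp \<phi> \<psi> = Neg (Conj \<phi> (Neg \<psi>))"

definition Iff :: "bformula \<Rightarrow> bformula \<Rightarrow> bformula" where
  "Iff \<phi> \<psi> = Conj (Imp \<phi> \<psi>) (Imp \<psi> \<phi>)"

definition BEx :: "nat \<Rightarrow> nat \<Rightarrow> bformula \<Rightarrow> bformula" where
  "BEx i j \<phi> = Neg (BAll i j (Neg \<phi>))"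

lemma sat_connectives [simp]:
  "sat S e (Disj \<phi> \<psi>) \<longleftrightarrow> sat S e \<phi> \<or> sat S e \<psi>"
  "sat S e (Imp \<phi> \<psi>) \<longleftrightarrow> (sat S e \<phi> \<longrightarrow> sat S e \<psi>)"
  "sat S e (Iff \<phi> \<psi>) \<longleftrightarrow> (sat S e \<phi> \<longleftrightarrow> sat S e \<psi>)"
  "sat S e (BEx i j \<phi>) \<longleftrightarrow> (\<exists>y \<in> elts S (e j). sat S (e(i := y)) \<phi>)"
  by (auto simp: Disj_def Imp_def Iff_def BEx_def)

text \<open>Auxiliary bound variables are chosen larger than all indices that occur as arguments.\<close>

definition IsUpair :: "nat \<Rightarrow> nat \<Rightarrow> nat \<Rightarrow> bformula" where
  "IsUpair u i j =
     (let w = Suc (u + i + j) in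
      Conj (Mem i u) (Conj (Mem j u) (BAll w u (Disj (Equal w i) (Equal w j)))))"

definition IsOpair :: "nat \<Rightarrow> nat \<Rightarrow> nat \<Rightarrow> bformula" where
  "IsOpair z i j =
     (let u = Suc (z + i + j) in
      Conj (BEx u z (IsUpair u i i)) (Conj (BEx u z (IsUpair u i j))
        (BAll u z (Disj (IsUpair u i i) (IsUpair u i j)))))"

definition Mem2 :: "nat \<Rightarrow> nat \<Rightarrow> nat \<Rightarrow> bformula" where
  "Mem2 i j r = (let p = Suc (i + j + r) in BEx p r (IsOpair p i j))"

text \<open>Every quantifier needs a bounding object: the inner pair \<open>q\<close> of a triple
  \<open>p\<close> is reached through a member \<open>u\<close> of \<open>p\<close> that contains
  \<open>q\<close>.\<close>

definition Mem3 :: "nat \<Rightarrow> nat \<Rightarrow> nat \<Rightarrow> nat \<Rightarrow> bformula" where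
  "Mem3 i j k r =
     (let p = Suc (i + j + k + r); u = Suc p; q = Suc u in
      BEx p r (BEx u p (BEx q u (Conj (IsOpair q i j) (IsOpair p q k)))))"

context superstr
begin

lemma sat_IsUpair: "sat S e (IsUpair u i j) \<longleftrightarrow> e u = mkset S {e i, e j}"
  unfolding eq_pair_iff by (auto simp: IsUpair_def Let_def)

lemma sat_IsOpair [simp]: "sat S e (IsOpair z i j) \<longleftrightarrow> e z = opair S (e i) (e j)"
  unfolding eq_opair_iff
  by (simp add: IsOpair_def Let_def sat_IsUpair) auto

lemma sat_Mem2 [simp]: "sat S e (Mem2 i j r) \<longleftrightarrow> opair S (e i) (e j) \<in> elts S (e r)"
  by (auto simp: Mem2_def Let_def)

lemma sat_Mem3 [simp]:
  "sat S e (Mem3 i j k r) \<longleftrightarrow> opair S (opair S (e i) (e j)) (e k) \<in> elts S (e r)"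
proof
  assume "opair S (opair S (e i) (e j)) (e k) \<in> elts S (e r)"
  then show "sat S e (Mem3 i j k r)"
    unfolding Mem3_def Let_def
    by (auto intro!: bexI[of _ "opair S (opair S (e i) (e j)) (e k)"])
qed (auto simp: Mem3_def Let_def)

end

section \<open>Transfer for relations on the reals\<close>

text \<open>Only pairs of atoms are recorded; these are the members that \<open>Mem2\<close>
  inspects when its arguments are hyperreals.\<close>

definition star_rel2 :: "('h, 'v, 'w) nsext \<Rightarrow> (real \<times> real) set \<Rightarrow> ('h \<times> 'h) set" where
  "star_rel2 N R =
     {(x, y). opair (nst N) (atom (nst N) x) (atom (nst N) y)
        \<in> elts (nst N) (star N (obj2 (std N) R))}"

definition star_rel3 ::
  "('h, 'v, 'w) nsext \<Rightarrow> (real \<times> real \<times> real) set \<Rightarrow> ('h \<times> 'h \<times> 'h) set" where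
  "star_rel3 N R =
     {(x, y, z). opair (nst N) (opair (nst N) (atom (nst N) x) (atom (nst N) y)) (atom (nst N) z)
        \<in> elts (nst N) (star N (obj3 (std N) R))}"

locale nsext =
  fixes N :: "('h :: linordered_field, 'v, 'w) nsext"
  assumes nonstandard_extension: "nonstandard_extension N"
begin

sublocale std: superstr "std N"
  using nonstandard_extension by unfold_locales (simp add: nonstandard_extension_def)

sublocale nst: superstr "nst N"
  using nonstandard_extension by unfold_locales (simp add: nonstandard_extension_def)

lemma transfer: "sat (nst N) (\<lambda>i. star N (e i)) \<phi> \<longleftrightarrow> sat (std N) e \<phi>"
  using nonstandard_extension
  by (simp add: nonstandard_extension_def transfer_principle_def)

section \<open>Extensions of atoms, pairs and sets of reals\<close>

lemma star_UNIV: "star N (obj1 (std N) UNIV) = obj1 (nst N) UNIV"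
  and star_plus: "star N (obj3 (std N) {(x, y, z). z = x + y}) = obj3 (nst N) {(x, y, z). z = x + y}"
  and star_times: "star N (obj3 (std N) {(x, y, z). z = x * y}) = obj3 (nst N) {(x, y, z). z = x * y}"
  and star_less: "star N (obj2 (std N) {(x, y). x < y}) = obj2 (nst N) {(x, y). x < y}"
  using nonstandard_extension by (simp_all add: nonstandard_extension_def)

text \<open>The pattern of all transfers below: the parameters form a list read by index as free
  variables, bound variables take higher indices, and evaluating \<open>sat\<close> on both sides
  yields a statement and its extension.\<close>

lemma star_mem_iff: "star N x \<in> elts (nst N) (star N y) \<longleftrightarrow> x \<in> elts (std N) y"
  using transfer[of "(!) [x, y]" "Mem 0 1"] by simp

lemma star_atom_in_range: "star N (atom (std N) r) \<in> range (atom (nst N))"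
  using star_mem_iff[of "atom (std N) r" "obj1 (std N) UNIV"] by (simp add: star_UNIV)

lemma star_atom [simp]: "star N (atom (std N) r) = atom (nst N) (hyper N r)"
proof -
  obtain h where "star N (atom (std N) r) = atom (nst N) h"
    using star_atom_in_range by blast
  then show ?thesis unfolding hyper_def by (metis (mono_tags, lifting) nst.atom_eq_iff theI)
qed

lemma star_opair [simp]: "star N (opair (std N) x y) = opair (nst N) (star N x) (star N y)"
  using transfer[of "(!) [opair (std N) x y, x, y]" "IsOpair 0 1 2"] by simp

text \<open>That every element of \<open>A\<close> is a real is a bounded statement, so the
  extension contains hyperreals only and passing to \<open>star_set\<close> loses nothing.\<close>

lemma elts_star_obj1 [simp]: "elts (nst N) (star N (obj1 (std N) A)) = atom (nst N) ` star_set N A"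
proof -
  have "sat (nst N) (\<lambda>i. star N ([obj1 (std N) UNIV, obj1 (std N) A] ! i)) (BAll 2 1 (Mem 2 0))"
    unfolding transfer by auto
  then have "elts (nst N) (star N (obj1 (std N) A)) \<subseteq> range (atom (nst N))"
    by (auto simp: star_UNIV)
  then show ?thesis unfolding star_set_def by blast
qed

text \<open>An empty extension would have the same elements as an atom. Being an atom is membership
  in the set of all reals, which transfers.\<close>

lemma star_obj1_not_atom: "star N (obj1 (std N) A) \<notin> range (atom (nst N))"
  using transfer[of "(!) [obj1 (std N) A, obj1 (std N) UNIV]" "Mem 0 1"] std.obj1_not_atom[of A]
  by (auto simp: star_UNIV)

lemma star_obj1: "star N (obj1 (std N) A) = obj1 (nst N) (star_set N A)"
  using star_obj1_not_atom nst.obj1_not_atom by (intro nst.elts_inject) auto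

lemma star_set_UNIV [simp]: "star_set N UNIV = UNIV"
  by (simp add: star_set_def star_UNIV)

lemma atom_in_image_iff [simp]: "atom (nst N) x \<in> atom (nst N) ` A \<longleftrightarrow> x \<in> A"
  by (rule inj_image_mem_iff[OF nst.inj_atom])

lemma std_atom_in_image_iff [simp]: "atom (std N) x \<in> atom (std N) ` A \<longleftrightarrow> x \<in> A"
  by (rule inj_image_mem_iff[OF std.inj_atom])

lemma opair_in_star_obj2 [simp]:
  "opair (nst N) (atom (nst N) x) (atom (nst N) y) \<in> elts (nst N) (star N (obj2 (std N) R)) \<longleftrightarrow>
   (x, y) \<in> star_rel2 N R"
  by (simp add: star_rel2_def)

lemma opair_in_star_obj3 [simp]:
  "opair (nst N) (opair (nst N) (atom (nst N) x) (atom (nst N) y)) (atom (nst N) z)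
     \<in> elts (nst N) (star N (obj3 (std N) R)) \<longleftrightarrow> (x, y, z) \<in> star_rel3 N R"
  by (simp add: star_rel3_def)

lemma star_rel2_less [simp]: "star_rel2 N {(x, y). x < y} = {(x, y). x < y}"
  by (simp add: star_rel2_def star_less)

lemma star_rel3_plus [simp]: "star_rel3 N {(x, y, z). z = x + y} = {(x, y, z). z = x + y}"
  by (simp add: star_rel3_def star_plus)

lemma star_rel3_times [simp]: "star_rel3 N {(x, y, z). z = x * y} = {(x, y, z). z = x * y}"
  by (simp add: star_rel3_def star_times)

section \<open>Embedding of the reals: membership, order and arithmetic\<close>

lemma hyper_in_star_set [simp]: "hyper N x \<in> star_set N A \<longleftrightarrow> x \<in> A"
  using transfer[of "(!) [atom (std N) x, obj1 (std N) A]" "Mem 0 1"] by simp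

lemma hyper_star_rel2: "(hyper N x, hyper N y) \<in> star_rel2 N R \<longleftrightarrow> (x, y) \<in> R"
  using transfer[of "(!) [atom (std N) x, atom (std N) y, obj2 (std N) R]" "Mem2 0 1 2"] by simp

lemma hyper_star_rel3: "(hyper N x, hyper N y, hyper N z) \<in> star_rel3 N R \<longleftrightarrow> (x, y, z) \<in> R"
  using transfer[of "(!) [atom (std N) x, atom (std N) y, atom (std N) z, obj3 (std N) R]"
    "Mem3 0 1 2 3"] by simp

lemma hyper_less_iff [simp]: "hyper N x < hyper N y \<longleftrightarrow> x < y"
  using hyper_star_rel2[of x y "{(x, y). x < y}"] by simp

lemma hyper_le_iff [simp]: "hyper N x \<le> hyper N y \<longleftrightarrow> x \<le> y"
  using hyper_less_iff[of y x] by (simp flip: not_less)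

lemma hyper_add: "hyper N (x + y) = hyper N x + hyper N y"
  using hyper_star_rel3[of x y "x + y" "{(x, y, z). z = x + y}"] by simp

lemma hyper_mult: "hyper N (x * y) = hyper N x * hyper N y"
  using hyper_star_rel3[of x y "x * y" "{(x, y, z). z = x * y}"] by simp

lemma hyper_0 [simp]: "hyper N 0 = 0"
  using hyper_add[of 0 0] by simp

lemma hyper_diff: "hyper N (x - y) = hyper N x - hyper N y"
  using hyper_add[of "x - y" y] by (simp add: algebra_simps)

text \<open>The image of 1 is idempotent, and it is nonzero because the embedding preserves the
  order.\<close>

lemma hyper_1 [simp]: "hyper N 1 = 1"
  using hyper_mult[of 1 1] hyper_less_iff[of 0 1] by auto

lemma star_set_mono:
  assumes "A \<subseteq> B" shows "star_set N A \<subseteq> star_set N B"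
proof -
  have "sat (nst N) (\<lambda>i. star N ([obj1 (std N) A, obj1 (std N) B] ! i)) (BAll 2 0 (Mem 2 1))"
    unfolding transfer using assms by auto
  then show ?thesis by auto
qed

lemma star_set_empty [simp]: "star_set N {} = {}"
proof -
  have "sat (nst N) (\<lambda>i. star N ([obj1 (std N) {}] ! i)) (BAll 1 0 (Neg (Equal 1 1)))"
    unfolding transfer by simp
  then show ?thesis by auto
qed

lemma star_set_greaterThanLessThan_subset: "star_set N {a<..<b} \<subseteq> {hyper N a<..<hyper N b}"
proof -
  have "sat (nst N)
      (\<lambda>i. star N ([obj1 (std N) {a<..<b}, obj2 (std N) {(x, y). x < y},
         atom (std N) a, atom (std N) b] ! i))
      (BAll 4 0 (Conj (Mem2 2 4 1) (Mem2 4 3 1)))"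
    unfolding transfer by simp
  then show ?thesis by auto
qed

lemma star_set_atLeastLessThan_subset: "star_set N {a..<b} \<subseteq> {hyper N a..<hyper N b}"
proof -
  \<comment> \<open>Formulas know the order only as \<open><\<close>, so a nonstrict inequality is
    the negation of the reversed strict one.\<close>
  have "sat (nst N)
      (\<lambda>i. star N ([obj1 (std N) {a..<b}, obj2 (std N) {(x, y). x < y},
         atom (std N) a, atom (std N) b] ! i))
      (BAll 4 0 (Conj (Neg (Mem2 4 2 1)) (Mem2 4 3 1)))"
    unfolding transfer by simp
  then show ?thesis by auto
qed

section \<open>Internality of extensions and of their sections\<close>

lemma internal_set_star_set: "internal_set N (star_set N A)"
proof -
  have "obj1 (std N) A \<in> elts (std N) (mkset (std N) {obj1 (std N) A})" by simp
  then show ?thesis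
    unfolding internal_set_def internal_def star_obj1[symmetric] using star_mem_iff by blast
qed

text \<open>Each section of \<open>R\<close> at a real is a member of the set \<open>?Z\<close> of
  all sets of reals. Transfer of this puts the section at any hyperreal \<open>h\<close> into the
  extension of \<open>?Z\<close>, which is what internality asks.\<close>

lemma internal_section:
  "internal_set N {x. (x, h) \<in> star_rel2 N R}"
proof -
  let ?Z = "mkset (std N) (range (obj1 (std N)))"
  have Z: "elts (std N) ?Z = range (obj1 (std N))"
    by (rule std.elts_mkset[of _ 1]) (use std.obj1_in_level in blast)
  \<comment> \<open>The clauses that the witness is no atom and has only atoms as elements are what
    later identifies it with an \<open>obj1\<close>.\<close>
  have "sat (nst N)
      (\<lambda>i. star N ([obj1 (std N) UNIV, ?Z, obj2 (std N) R] ! i))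
      (BAll 3 0 (BEx 4 1 (Conj (Neg (Mem 4 0)) (Conj (BAll 5 4 (Mem 5 0))
         (BAll 5 0 (Iff (Mem 5 4) (Mem2 5 3 2)))))))"
    unfolding transfer
  proof (simp add: Z, intro allI)
    fix r
    show "\<exists>A. obj1 (std N) A \<notin> range (atom (std N)) \<and> (\<forall>x. x \<in> A \<longleftrightarrow> (x, r) \<in> R)"
      using std.obj1_not_atom by (intro exI[of _ "{x. (x, r) \<in> R}"]) auto
  qed
  then obtain a where a: "a \<in> elts (nst N) (star N ?Z)" "a \<notin> range (atom (nst N))"
    "elts (nst N) a \<subseteq> range (atom (nst N))"
    "\<And>x. atom (nst N) x \<in> elts (nst N) a \<longleftrightarrow> (x, h) \<in> star_rel2 N R"
    by (simp add: image_subset_iff) blast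
  have "a = obj1 (nst N) {x. (x, h) \<in> star_rel2 N R}"
    using a nst.obj1_not_atom by (intro nst.elts_inject) auto
  then show ?thesis using a(1) unfolding internal_set_def internal_def by blast
qed

text \<open>The argument for sets, with the set of all binary relations as \<open>?Z\<close> and a
  clause that the witness consists of pairs of atoms. It makes functions that are defined uniformly
  from a code internal.\<close>

lemma internal_section3:
  "internal N (obj2 (nst N) {(x, y). (x, y, h) \<in> star_rel3 N R})"
proof -
  let ?Z = "mkset (std N) (range (obj2 (std N)))"
  have Z: "elts (std N) ?Z = range (obj2 (std N))"
    by (rule std.elts_mkset[of _ 3]) (use std.obj2_in_level in blast)
  have "sat (nst N)
      (\<lambda>i. star N ([obj1 (std N) UNIV, ?Z, obj3 (std N) R] ! i))
      (BAll 3 0 (BEx 4 1 (Conj (Neg (Mem 4 0))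
         (Conj (BAll 7 4 (BEx 5 0 (BEx 6 0 (IsOpair 7 5 6))))
         (BAll 5 0 (BAll 6 0 (Iff (Mem2 5 6 4) (Mem3 5 6 3 2))))))))"
    unfolding transfer
  proof (simp add: Z, intro allI)
    fix r
    show "\<exists>A. obj2 (std N) A \<notin> range (atom (std N)) \<and>
      (\<forall>p\<in>elts (std N) (obj2 (std N) A). \<exists>x y. p = opair (std N) (atom (std N) x) (atom (std N) y)) \<and>
      (\<forall>x y. (x, y) \<in> A \<longleftrightarrow> (x, y, r) \<in> R)"
      using std.obj2_not_atom
      by (intro exI[of _ "{(x, y). (x, y, r) \<in> R}"]) (auto simp: std.elts_obj2)
  qed
  then obtain a where a: "a \<in> elts (nst N) (star N ?Z)" "a \<notin> range (atom (nst N))"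
    "\<And>p. p \<in> elts (nst N) a \<Longrightarrow> \<exists>x y. p = opair (nst N) (atom (nst N) x) (atom (nst N) y)"
    "\<And>x y. opair (nst N) (atom (nst N) x) (atom (nst N) y) \<in> elts (nst N) a \<longleftrightarrow> (x, y, h) \<in> star_rel3 N R"
    by simp blast
  have "elts (nst N) a = elts (nst N) (obj2 (nst N) {(x, y). (x, y, h) \<in> star_rel3 N R})"
    unfolding nst.elts_obj2 using a(3,4) by (force simp: image_iff)
  then have "a = obj2 (nst N) {(x, y). (x, y, h) \<in> star_rel3 N R}"
    using a(2) nst.obj2_not_atom by (intro nst.elts_inject) auto
  then show ?thesis using a(1) unfolding internal_def by blast
qed

section \<open>Infinite closeness to reals and standard parts\<close>

lemma inf_close_hyper_iff:
  "inf_close N x (hyper N r) \<longleftrightarrow> (\<forall>e>0. hyper N (r - e) < x \<and> x < hyper N (r + e))"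
  by (auto simp: inf_close_def infinitesimal_def hyper_diff hyper_add abs_less_iff algebra_simps)

lemma inf_close_hyper_unique:
  assumes "inf_close N x (hyper N r)" "inf_close N x (hyper N s)"
  shows "r = s"
proof (rule ccontr)
  assume "r \<noteq> s"
  \<comment> \<open>With half the distance as tolerance, the two intervals that should both contain
    \<open>x\<close> are disjoint.\<close>
  then have "\<bar>r - s\<bar> / 2 > 0" by simp
  then have "hyper N (r - \<bar>r - s\<bar> / 2) < hyper N (s + \<bar>r - s\<bar> / 2)"
    and "hyper N (s - \<bar>r - s\<bar> / 2) < hyper N (r + \<bar>r - s\<bar> / 2)"
    using assms unfolding inf_close_hyper_iff by (blast intro: less_trans)+
  then show False by (auto simp: abs_if field_simps split: if_splits)
qed

lemma st_eqI: "inf_close N x (hyper N r) \<Longrightarrow> st N x = r"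
  unfolding st_def using inf_close_hyper_unique by blast

text \<open>The standard part is the supremum of the reals whose images lie at or below
  \<open>x\<close>; completeness of the reals applies because \<open>a\<close> is one of them and
  \<open>b\<close> bounds them.\<close>

lemma st_in_interval:
  assumes "hyper N a \<le> x" "x \<le> hyper N b"
  shows "st N x \<in> {a..b}"
proof -
  define Q where "Q = {q. hyper N q \<le> x}"
  have Qb: "q \<le> b" if "q \<in> Q" for q
    using that assms(2) unfolding Q_def by (metis hyper_le_iff mem_Collect_eq order_trans)
  then have bdd: "bdd_above Q" by (rule bdd_aboveI)
  have aQ: "a \<in> Q" using assms(1) by (simp add: Q_def)
  have "inf_close N x (hyper N (Sup Q))"
    unfolding inf_close_hyper_iff
  proof (intro allI impI conjI)
    fix e :: real assume e: "e > 0"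
    obtain q where "q \<in> Q" "Sup Q - e < q"
      using less_cSup_iff[OF _ bdd, of "Sup Q - e"] aQ e by auto
    then show "hyper N (Sup Q - e) < x"
      unfolding Q_def by (metis hyper_less_iff less_le_trans mem_Collect_eq)
    have "Sup Q + e \<notin> Q" using cSup_upper[OF _ bdd, of "Sup Q + e"] e by auto
    then show "x < hyper N (Sup Q + e)" by (simp add: Q_def)
  qed
  moreover have "a \<le> Sup Q" using aQ bdd by (rule cSup_upper)
  moreover have "Sup Q \<le> b" using aQ Qb by (intro cSup_least) auto
  ultimately show ?thesis using st_eqI by auto
qed

end

section \<open>Hyperfinite sets coded by hyperreals\<close>

text \<open>The rank numbers a finite set of reals without any choice, so one relation, uniform in
  the set, does it for all codes and can be extended.\<close>

lemma bij_betw_card_le: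
  fixes A :: "'a :: linorder set"
  assumes "finite A"
  shows "bij_betw (\<lambda>x. card {y \<in> A. y \<le> x}) A {1..card A}"
proof -
  have inj: "inj_on (\<lambda>x. card {y \<in> A. y \<le> x}) A"
  proof (rule linorder_inj_onI')
    fix x z assume "x \<in> A" "z \<in> A" "x < z"
    then have "{y \<in> A. y \<le> x} \<subseteq> {y \<in> A. y \<le> z}"
      and "z \<in> {y \<in> A. y \<le> z}" "z \<notin> {y \<in> A. y \<le> x}" by auto
    then have "{y \<in> A. y \<le> x} \<subset> {y \<in> A. y \<le> z}" by blast
    then show "card {y \<in> A. y \<le> x} \<noteq> card {y \<in> A. y \<le> z}"
      using psubset_card_mono[of "{y \<in> A. y \<le> z}" "{y \<in> A. y \<le> x}"] assms by simp
  qed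
  moreover have "(\<lambda>x. card {y \<in> A. y \<le> x}) ` A \<subseteq> {1..card A}"
  proof clarify
    fix x assume "x \<in> A"
    then have "x \<in> {y \<in> A. y \<le> x}" by simp
    then have "card {y \<in> A. y \<le> x} > 0" using assms by (auto simp: card_gt_0_iff)
    moreover have "card {y \<in> A. y \<le> x} \<le> card A" using assms by (auto intro: card_mono)
    ultimately show "card {y \<in> A. y \<le> x} \<in> {1..card A}" by simp
  qed
  ultimately show ?thesis
    using card_image[OF inj] by (simp add: bij_betw_def card_subset_eq)
qed

text \<open>A real codes a set of naturals, which \<open>prod_encode\<close> splits into a sequence
  of rows, again sets of naturals. Row 0 holds the length of a list and the later rows code its
  entries.\<close>

lemma finite_sets_of_reals_enumeration: "\<exists>D :: real \<Rightarrow> real set. range D = {A. finite A}"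
proof -
  obtain g :: "real \<Rightarrow> nat set" where g: "bij g"
    using nat_sets_eqpoll_reals unfolding eqpoll_def by (metis bij_betw_inv_into)
  obtain h :: "nat set \<Rightarrow> real" where h: "bij h"
    using nat_sets_eqpoll_reals unfolding eqpoll_def by auto
  \<comment> \<open>Row 0 is meant to be a singleton, from which \<open>Min\<close> reads the
    length; for any other row 0 the image is still finite, as the range requires.\<close>
  define D where
    "D r = (let s = (\<lambda>i. {k. prod_encode (i, k) \<in> g r}) in (h \<circ> s \<circ> Suc) ` {..<Min (s 0)})" for r
  have "A \<in> range D" if fin: "finite A" for A
  proof -
    obtain xs where xs: "set xs = A" using fin finite_list by blast
    define s where "s i = (case i of 0 \<Rightarrow> {length xs} | Suc j \<Rightarrow> inv h (xs ! j))" for i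
    obtain r where r: "g r = prod_encode ` {(i, k). k \<in> s i}"
      using g by (metis bij_pointE)
    have "{k. prod_encode (i, k) \<in> g r} = s i" for i
      unfolding r by (auto simp: image_iff inj_eq[OF inj_prod_encode])
    then have "D r = (h \<circ> s \<circ> Suc) ` {..<length xs}" by (simp add: D_def s_def)
    also have "\<dots> = (!) xs ` {..<length xs}"
      using h by (auto simp: s_def image_iff bij_is_surj surj_f_inv_f)
    also have "\<dots> = A" using xs by (auto simp: set_conv_nth)
    finally show ?thesis by auto
  qed
  moreover have "finite (D r)" for r by (simp add: D_def Let_def)
  ultimately show ?thesis by blast
qed

definition decode :: "real \<Rightarrow> real set" where
  "decode = (SOME D. range D = {A. finite A})"

lemma range_decode: "range decode = {A. finite A}"
  unfolding decode_def by (rule someI_ex[OF finite_sets_of_reals_enumeration])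

lemma finite_decode [simp]: "finite (decode r)"
  using range_decode by (metis mem_Collect_eq rangeI)

lemma ex_decode: "finite A \<Longrightarrow> \<exists>r. decode r = A"
  using range_decode by (metis (mono_tags) mem_Collect_eq rangeE)

definition hfin :: "('h, 'v, 'w) nsext \<Rightarrow> 'h \<Rightarrow> 'h set" where
  "hfin N h = {x. (x, h) \<in> star_rel2 N {(x, r). x \<in> decode r}}"

text \<open>Cardinality as a relation between codes and values, so that formulas can speak of
  it.\<close>

definition hcard_of_code :: "('h, 'v, 'w) nsext \<Rightarrow> 'h \<Rightarrow> 'h \<Rightarrow> bool" where
  "hcard_of_code N h n \<longleftrightarrow> (h, n) \<in> star_rel2 N {(r, n). n = real (card (decode r))}"

text \<open>A pigeonhole principle: \<open>F\<close> leads from an index \<open>k\<close> to a point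
  and \<open>G\<close> from that point to an index \<open>l\<close>; the hypotheses make this
  injective. Relations replace functions so that the statement applies to graphs and can be
  transferred.\<close>

lemma card_le_of_relations:
  fixes F G :: "(real \<times> real) set"
  assumes "n \<in> \<nat>" "m \<in> \<nat>"
    and cover: "\<And>k. \<lbrakk>k \<in> \<nat>; 1 \<le> k; k \<le> n\<rbrakk> \<Longrightarrow> \<exists>x. (x, k) \<in> F \<and> (\<exists>l\<in>\<nat>. (x, l) \<in> G \<and> 1 \<le> l \<and> l \<le> m)"
    and F: "\<And>x k l. \<lbrakk>(x, k) \<in> F; (x, l) \<in> F\<rbrakk> \<Longrightarrow> k = l"
    and G: "\<And>x y l. \<lbrakk>(x, l) \<in> G; (y, l) \<in> G\<rbrakk> \<Longrightarrow> x = y"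
  shows "n \<le> m"
proof -
  obtain a b where ab: "n = real a" "m = real b" using assms(1,2) by (auto simp: Nats_def)
  have "\<exists>x l. (x, real k) \<in> F \<and> (x, real l) \<in> G \<and> l \<in> {1..b}" if "k \<in> {1..a}" for k
    using cover[of "real k"] that by (force simp: ab Nats_def)
  then obtain x l where xl: "\<And>k. k \<in> {1..a} \<Longrightarrow> (x k, real k) \<in> F \<and> (x k, real (l k)) \<in> G \<and> l k \<in> {1..b}"
    by metis
  have "inj_on l {1..a}"
  proof (rule inj_onI)
    fix i j assume ij: "i \<in> {1..a}" "j \<in> {1..a}" "l i = l j"
    then have "x i = x j" using xl G by metis
    then show "i = j" using xl[OF ij(1)] xl[OF ij(2)] F by fastforce
  qed
  then have "card {1..a} \<le> card {1..b}" using xl by (intro card_inj_on_le[of l]) auto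
  then show ?thesis by (simp add: ab)
qed

section \<open>Internal cardinality of coded sets\<close>

context nsext
begin

text \<open>Transfer of the pigeonhole principle to two internal enumerations of one set; exchanging
  them gives uniqueness of the internal cardinality.\<close>

lemma has_hcard_le:
  assumes "has_hcard N A H" "has_hcard N A K"
  shows "H \<le> K"
proof -
  let ?I = "\<lambda>H. {k \<in> star_set N \<nat>. 1 \<le> k \<and> k \<le> H}"
  obtain f g where f: "bij_betw f A (?I H)" "internal N (obj2 (nst N) {(x, f x) |x. x \<in> A})"
    and g: "bij_betw g A (?I K)" "internal N (obj2 (nst N) {(x, g x) |x. x \<in> A})"
    and HK: "H \<in> star_set N \<nat>" "K \<in> star_set N \<nat>"
    using assms by (auto simp: has_hcard_def internal_bij_betw_def)
  let ?F = "obj2 (nst N) {(x, f x) |x. x \<in> A}" and ?G = "obj2 (nst N) {(x, g x) |x. x \<in> A}"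
  \<comment> \<open>Internality provides standard objects whose extensions contain the graphs, and
    these bound the quantifiers over graphs.\<close>
  obtain Y Z where YZ: "?F \<in> elts (nst N) (star N Y)" "?G \<in> elts (nst N) (star N Z)"
    using f(2) g(2) by (auto simp: internal_def)
  let ?hyp = "\<lambda>F G n m. (\<forall>k\<in>\<nat>. 1 \<le> k \<and> k \<le> n \<longrightarrow> (\<exists>x. opair (std N) (atom (std N) x) (atom (std N) k) \<in> elts (std N) F \<and>
          (\<exists>l\<in>\<nat>. opair (std N) (atom (std N) x) (atom (std N) l) \<in> elts (std N) G \<and> 1 \<le> l \<and> l \<le> m))) \<and>
       (\<forall>x k l. opair (std N) (atom (std N) x) (atom (std N) k) \<in> elts (std N) F \<and>
          opair (std N) (atom (std N) x) (atom (std N) l) \<in> elts (std N) F \<longrightarrow> k = l) \<and>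
       (\<forall>x y l. opair (std N) (atom (std N) x) (atom (std N) l) \<in> elts (std N) G \<and>
          opair (std N) (atom (std N) y) (atom (std N) l) \<in> elts (std N) G \<longrightarrow> x = y)"
  have standard: "\<forall>F\<in>elts (std N) Y. \<forall>G\<in>elts (std N) Z. \<forall>n\<in>\<nat>. \<forall>m\<in>\<nat>. ?hyp F G n m \<longrightarrow> n \<le> m"
  proof (intro ballI impI)
    fix F G n m
    assume "n \<in> \<nat>" "m \<in> \<nat>" "?hyp F G n m"
    then show "n \<le> m"
      by (intro card_le_of_relations[of n m
            "{(x, y). opair (std N) (atom (std N) x) (atom (std N) y) \<in> elts (std N) F}"
            "{(x, y). opair (std N) (atom (std N) x) (atom (std N) y) \<in> elts (std N) G}"];
          simp; blast)
  qed
  \<comment> \<open>Variables 6 and 7 are the graphs, 8 and 9 the two cardinalities.\<close>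
  have "sat (nst N)
      (\<lambda>i. star N ([obj1 (std N) UNIV, Y, Z, obj1 (std N) \<nat>, obj2 (std N) {(x, y). x < y},
         atom (std N) 1] ! i))
      (BAll 6 1 (BAll 7 2 (BAll 8 3 (BAll 9 3
        (Imp (Conj (BAll 10 3 (Imp (Conj (Neg (Mem2 10 5 4)) (Neg (Mem2 8 10 4)))
                (BEx 11 0 (Conj (Mem2 11 10 6)
                   (BEx 12 3 (Conj (Mem2 11 12 7) (Conj (Neg (Mem2 12 5 4)) (Neg (Mem2 9 12 4)))))))))
             (Conj (BAll 11 0 (BAll 10 0 (BAll 12 0
                (Imp (Conj (Mem2 11 10 6) (Mem2 11 12 6)) (Equal 10 12)))))
              (BAll 11 0 (BAll 10 0 (BAll 12 0
                (Imp (Conj (Mem2 11 12 7) (Mem2 10 12 7)) (Equal 11 10)))))))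
          (Neg (Mem2 9 8 4)))))))"
    unfolding transfer
    by (rule iffD2[OF _ standard]) (simp add: not_less)
  then have "\<forall>F\<in>elts (nst N) (star N Y). \<forall>G\<in>elts (nst N) (star N Z).
      \<forall>n\<in>star_set N \<nat>. \<forall>m\<in>star_set N \<nat>.
      (\<forall>k\<in>star_set N \<nat>. 1 \<le> k \<and> k \<le> n \<longrightarrow> (\<exists>x. opair (nst N) (atom (nst N) x) (atom (nst N) k) \<in> elts (nst N) F \<and>
          (\<exists>l\<in>star_set N \<nat>. opair (nst N) (atom (nst N) x) (atom (nst N) l) \<in> elts (nst N) G \<and> 1 \<le> l \<and> l \<le> m))) \<and>
       (\<forall>x k l. opair (nst N) (atom (nst N) x) (atom (nst N) k) \<in> elts (nst N) F \<and>
          opair (nst N) (atom (nst N) x) (atom (nst N) l) \<in> elts (nst N) F \<longrightarrow> k = l) \<and>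
       (\<forall>x y l. opair (nst N) (atom (nst N) x) (atom (nst N) l) \<in> elts (nst N) G \<and>
          opair (nst N) (atom (nst N) y) (atom (nst N) l) \<in> elts (nst N) G \<longrightarrow> x = y) \<longrightarrow> n \<le> m"
    by (rule iffD1[rotated]) (simp add: not_less)
  note this[rule_format, OF YZ HK]
  \<comment> \<open>The point that \<open>f\<close> numbers \<open>k\<close> also has a number under
    \<open>g\<close>: this is the covering hypothesis of the pigeonhole principle.\<close>
  moreover have "\<exists>x. x \<in> A \<and> k = f x \<and> g x \<in> star_set N \<nat> \<and> 1 \<le> g x \<and> g x \<le> K"
    if "k \<in> star_set N \<nat>" "1 \<le> k" "k \<le> H" for k
    using that f(1) g(1) unfolding bij_betw_def by (auto simp: set_eq_iff image_iff)
  ultimately show ?thesis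
    using bij_betw_imp_inj_on[OF g(1)] by (auto dest: inj_onD)
qed

lemma hcard_eqI: "has_hcard N A H \<Longrightarrow> hcard N A = H"
  unfolding hcard_def by (metis has_hcard_le order_antisym the_equality)

text \<open>The relation \<open>?T\<close> collects the rank functions of all coded sets. Its
  section at \<open>h\<close> is internal, and by transfer it is the graph of a bijection from
  \<open>hfin N h\<close> onto the hypernaturals from 1 to \<open>H\<close>.\<close>

lemma has_hcard_hfin:
  assumes "hcard_of_code N h H"
  shows "has_hcard N (hfin N h) H"
proof -
  let ?E = "{(x, r). x \<in> decode r}"
  let ?T = "{(x, k, r). x \<in> decode r \<and> k = real (card {y \<in> decode r. y \<le> x})}"
  let ?C = "{(r, n). n = real (card (decode r))}"
  let ?rank = "\<lambda>r x. real (card {y \<in> decode r. y \<le> x})"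
  have standard: "\<forall>r n. n = real (card (decode r)) \<longrightarrow> n \<in> \<nat> \<and>
     (\<forall>x k. x \<in> decode r \<and> k = ?rank r x \<longrightarrow> x \<in> decode r \<and> k \<in> \<nat> \<and> 1 \<le> k \<and> k \<le> n) \<and>
     (\<forall>x. x \<in> decode r \<longrightarrow> (\<exists>k. x \<in> decode r \<and> k = ?rank r x)) \<and>
     (\<forall>x k l. (x \<in> decode r \<and> k = ?rank r x) \<and> (x \<in> decode r \<and> l = ?rank r x) \<longrightarrow> k = l) \<and>
     (\<forall>x k y. (x \<in> decode r \<and> k = ?rank r x) \<and> (y \<in> decode r \<and> k = ?rank r y) \<longrightarrow> x = y) \<and>
     (\<forall>k\<in>\<nat>. 1 \<le> k \<and> k \<le> n \<longrightarrow> (\<exists>x. x \<in> decode r \<and> k = ?rank r x))"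
  proof (intro allI impI conjI ballI)
    fix r n x k y assume n: "n = real (card (decode r))"
    note bij = bij_betw_card_le[OF finite_decode[of r]]
    show "n \<in> \<nat>" using n by simp
    {
      assume "x \<in> decode r \<and> k = ?rank r x"
      moreover from this have "card {y \<in> decode r. y \<le> x} \<in> {1..card (decode r)}"
        using bij unfolding bij_betw_def by blast
      ultimately show "k \<in> \<nat>" "1 \<le> k" "k \<le> n" using n by auto
    }
    {
      assume "(x \<in> decode r \<and> k = ?rank r x) \<and> (y \<in> decode r \<and> k = ?rank r y)"
      then show "x = y" using bij unfolding bij_betw_def by (auto dest: inj_onD)
    }
    {
      assume "k \<in> \<nat>" "1 \<le> k \<and> k \<le> n"
      then obtain j where j: "k = real j" "j \<in> {1..card (decode r)}"
        using n by (auto simp: Nats_def)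
      then obtain x where "x \<in> decode r" "card {y \<in> decode r. y \<le> x} = j"
        using bij unfolding bij_betw_def by (metis (no_types, lifting) imageE)
      then show "\<exists>x. x \<in> decode r \<and> k = ?rank r x" using j by blast
    }
  qed auto
  have "sat (nst N)
      (\<lambda>i. star N ([obj1 (std N) UNIV, obj2 (std N) ?E, obj3 (std N) ?T, obj2 (std N) ?C, obj1 (std N) \<nat>,
          obj2 (std N) {(x, y). x < y}, atom (std N) 1] ! i))
      (BAll 7 0 (BAll 8 0 (Imp (Mem2 7 8 3)
        (Conj (Mem 8 4)
        (Conj (BAll 9 0 (BAll 10 0 (Imp (Mem3 9 10 7 2)
           (Conj (Mem2 9 7 1) (Conj (Mem 10 4) (Conj (Neg (Mem2 10 6 5)) (Neg (Mem2 8 10 5))))))))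
        (Conj (BAll 9 0 (Imp (Mem2 9 7 1) (BEx 10 0 (Mem3 9 10 7 2))))
        (Conj (BAll 9 0 (BAll 10 0 (BAll 11 0 (Imp (Conj (Mem3 9 10 7 2) (Mem3 9 11 7 2)) (Equal 10 11)))))
        (Conj (BAll 9 0 (BAll 10 0 (BAll 11 0 (Imp (Conj (Mem3 9 10 7 2) (Mem3 11 10 7 2)) (Equal 9 11)))))
        (BAll 10 4 (Imp (Conj (Neg (Mem2 10 6 5)) (Neg (Mem2 8 10 5))) (BEx 9 0 (Mem3 9 10 7 2)))))))))
      )))"
    unfolding transfer
    by (rule iffD2[OF _ standard]) (simp add: not_less)
  then have T: "H \<in> star_set N \<nat>"
    "\<And>x k. (x, k, h) \<in> star_rel3 N ?T \<Longrightarrow> x \<in> hfin N h \<and> k \<in> star_set N \<nat> \<and> 1 \<le> k \<and> k \<le> H"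
    "\<And>x. x \<in> hfin N h \<Longrightarrow> \<exists>k. (x, k, h) \<in> star_rel3 N ?T"
    "\<And>x k l. \<lbrakk>(x, k, h) \<in> star_rel3 N ?T; (x, l, h) \<in> star_rel3 N ?T\<rbrakk> \<Longrightarrow> k = l"
    "\<And>x y k. \<lbrakk>(x, k, h) \<in> star_rel3 N ?T; (y, k, h) \<in> star_rel3 N ?T\<rbrakk> \<Longrightarrow> x = y"
    "\<And>k. \<lbrakk>k \<in> star_set N \<nat>; 1 \<le> k; k \<le> H\<rbrakk> \<Longrightarrow> \<exists>x. (x, k, h) \<in> star_rel3 N ?T"
    using assms by (simp_all add: not_less hfin_def hcard_of_code_def)
  define f where "f x = (THE k. (x, k, h) \<in> star_rel3 N ?T)" for x
  have f: "f x = k" if "(x, k, h) \<in> star_rel3 N ?T" for x k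
    unfolding f_def using that T(4) by blast
  have fT: "(x, f x, h) \<in> star_rel3 N ?T" if x: "x \<in> hfin N h" for x
  proof -
    obtain k where "(x, k, h) \<in> star_rel3 N ?T" using T(3)[OF x] ..
    with f show ?thesis by simp
  qed
  have graph: "{(x, f x) |x. x \<in> hfin N h} = {(x, y). (x, y, h) \<in> star_rel3 N ?T}"
    using T(2) f fT by blast
  have "bij_betw f (hfin N h) {k \<in> star_set N \<nat>. 1 \<le> k \<and> k \<le> H}"
  proof (rule bij_betw_imageI)
    show "inj_on f (hfin N h)"
    proof (rule inj_onI)
      fix x y assume "x \<in> hfin N h" "y \<in> hfin N h" "f x = f y"
      then show "x = y" using fT[of x] fT[of y] T(5)[of x "f x" y] by simp
    qed
    show "f ` hfin N h = {k \<in> star_set N \<nat>. 1 \<le> k \<and> k \<le> H}"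
    proof (intro equalityI subsetI)
      fix k assume "k \<in> {k \<in> star_set N \<nat>. 1 \<le> k \<and> k \<le> H}"
      then obtain x where "(x, k, h) \<in> star_rel3 N ?T" using T(6) by blast
      then show "k \<in> f ` hfin N h" using T(2)[of x k] f[of x k] by blast
    qed (use T(2) fT in blast)
  qed
  then show ?thesis
    using T(1) internal_section internal_section3[of h ?T]
    unfolding has_hcard_def internal_bij_betw_def graph[symmetric]
    by (auto simp: hfin_def)
qed

lemma ex_hcard_of_code: "\<exists>H. hcard_of_code N h H"
proof -
  have "sat (nst N)
      (\<lambda>i. star N ([obj1 (std N) UNIV, obj2 (std N) {(r, n). n = real (card (decode r))}] ! i))
      (BAll 2 0 (BEx 3 0 (Mem2 2 3 1)))"
    unfolding transfer by auto
  then show ?thesis by (auto simp: hcard_of_code_def)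
qed

lemma hyperfinite_hfin: "hyperfinite N (hfin N h)"
  using ex_hcard_of_code has_hcard_hfin unfolding hyperfinite_def by blast

lemma hcard_hfin: "hcard_of_code N h H \<Longrightarrow> hcard N (hfin N h) = H"
  by (intro hcard_eqI has_hcard_hfin)

lemma hcard_hfin_mono:
  assumes "hfin N g \<subseteq> hfin N h"
  shows "hcard N (hfin N g) \<le> hcard N (hfin N h)"
proof -
  obtain G H where GH: "hcard_of_code N g G" "hcard_of_code N h H"
    using ex_hcard_of_code by meson
  have "sat (nst N)
      (\<lambda>i. star N ([obj1 (std N) UNIV, obj2 (std N) {(x, r). x \<in> decode r},
         obj2 (std N) {(r, n). n = real (card (decode r))}, obj2 (std N) {(x, y). x < y}] ! i))
      (BAll 4 0 (BAll 5 0 (Imp (BAll 6 0 (Imp (Mem2 6 4 1) (Mem2 6 5 1)))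
        (BAll 7 0 (BAll 8 0 (Imp (Conj (Mem2 4 7 2) (Mem2 5 8 2)) (Neg (Mem2 8 7 3))))))))"
    unfolding transfer by (auto simp: not_less subset_iff intro!: card_mono)
  then show ?thesis
    using assms unfolding hcard_hfin[OF GH(1)] hcard_hfin[OF GH(2)]
    using GH by (simp add: not_less hcard_of_code_def hfin_def subset_iff)
qed

lemma hcard_hfin_pos:
  assumes "hfin N h \<noteq> {}"
  shows "hcard N (hfin N h) > 0"
proof -
  obtain H where H: "has_hcard N (hfin N h) H"
    using hyperfinite_hfin unfolding hyperfinite_def by blast
  then obtain f where "f ` hfin N h = {k \<in> star_set N \<nat>. 1 \<le> k \<and> k \<le> H}"
    by (auto simp: has_hcard_def internal_bij_betw_def bij_betw_def)
  then obtain k where "1 \<le> k" "k \<le> H" using assms by blast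
  then have "H > 0" by (meson less_le_trans order_trans zero_less_one)
  then show ?thesis using hcard_eqI[OF H] by simp
qed

lemma hcard_empty: "hcard N {} = 0"
proof (rule hcard_eqI)
  have "\<not> (1 \<le> k \<and> k \<le> 0)" for k :: 'h
    using zero_less_one[where 'a='h] by (metis leD order_trans)
  moreover have "internal_set N {}" using internal_set_star_set[of "{}"] by simp
  \<comment> \<open>The empty graph and the empty set are the same object of the
    superstructure.\<close>
  moreover have "internal N (obj2 (nst N) {})"
    using internal_set_star_set[of "{}"] by (simp add: internal_set_def obj1_def obj2_def)
  ultimately show "has_hcard N {} 0"
    using hyper_in_star_set[of 0 \<nat>] by (simp add: has_hcard_def internal_bij_betw_def bij_betw_def)
qed

text \<open>A subset of a finite set is finite and so has a code. Transferred over the members of a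
  standard \<open>Z\<close>, this codes every internal subset, so the hypotheses need checking on
  coded sets only.\<close>

lemma internal_subset_hfin:
  assumes "internal_set N A" "A \<subseteq> hfin N h"
  shows "\<exists>g. A = hfin N g"
proof -
  obtain Z where Z: "obj1 (nst N) A \<in> elts (nst N) (star N Z)"
    using assms(1) by (auto simp: internal_set_def internal_def)
  have standard: "\<forall>a\<in>elts (std N) Z. \<forall>r.
      (\<forall>x\<in>elts (std N) a. opair (std N) x (atom (std N) r) \<in> elts (std N) (obj2 (std N) {(x, r). x \<in> decode r}))
      \<longrightarrow> (\<exists>s. \<forall>x. atom (std N) x \<in> elts (std N) a \<longleftrightarrow> x \<in> decode s)"
  proof (intro ballI allI impI)
    fix a r
    assume a: "\<forall>x\<in>elts (std N) a.
      opair (std N) x (atom (std N) r) \<in> elts (std N) (obj2 (std N) {(x, r). x \<in> decode r})"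
    have "{x. atom (std N) x \<in> elts (std N) a} \<subseteq> decode r" using a by fastforce
    then have "finite {x. atom (std N) x \<in> elts (std N) a}" by (rule finite_subset) simp
    from ex_decode[OF this] show "\<exists>s. \<forall>x. atom (std N) x \<in> elts (std N) a \<longleftrightarrow> x \<in> decode s" by blast
  qed
  have "sat (nst N)
      (\<lambda>i. star N ([obj1 (std N) UNIV, obj2 (std N) {(x, r). x \<in> decode r}, Z] ! i))
      (BAll 3 2 (BAll 4 0 (Imp (BAll 5 3 (Mem2 5 4 1))
        (BEx 6 0 (BAll 7 0 (Iff (Mem 7 3) (Mem2 7 6 1)))))))"
    unfolding transfer
    by (rule iffD2[OF _ standard]) simp
  then have "\<forall>a\<in>elts (nst N) (star N Z).
      (\<exists>h. \<forall>x\<in>elts (nst N) a. opair (nst N) x (atom (nst N) h) \<in> elts (nst N) (star N (obj2 (std N) {(x, r). x \<in> decode r})))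
      \<longrightarrow> (\<exists>g. \<forall>x. atom (nst N) x \<in> elts (nst N) a \<longleftrightarrow> x \<in> hfin N g)"
    by (simp add: hfin_def)
  note this[rule_format, OF Z]
  moreover have "\<forall>x\<in>elts (nst N) (obj1 (nst N) A).
      opair (nst N) x (atom (nst N) h) \<in> elts (nst N) (star N (obj2 (std N) {(x, r). x \<in> decode r}))"
    using assms(2) by (auto simp: hfin_def)
  ultimately have "\<exists>g. \<forall>x. x \<in> A \<longleftrightarrow> x \<in> hfin N g" by auto
  then show ?thesis by blast
qed

text \<open>Any set of reals, measurable or not, meets a finite set in a finite set, which again has
  a code.\<close>

lemma star_set_Int_hfin: "\<exists>g. star_set N A \<inter> hfin N h = hfin N g"
proof -
  have "sat (nst N)
      (\<lambda>i. star N ([obj1 (std N) UNIV, obj2 (std N) {(x, r). x \<in> decode r}, obj1 (std N) A] ! i))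
      (BAll 3 0 (BEx 4 0 (BAll 5 0 (Iff (Conj (Mem 5 2) (Mem2 5 3 1)) (Mem2 5 4 1)))))"
    unfolding transfer
  proof (simp, intro allI)
    fix r
    obtain s where "decode s = A \<inter> decode r" using ex_decode[of "A \<inter> decode r"] by auto
    then show "\<exists>s. \<forall>x. (x \<in> A \<and> x \<in> decode r) = (x \<in> decode s)" by auto
  qed
  then show ?thesis by (auto simp: hfin_def set_eq_iff)
qed

end

section \<open>Finite approximation of Lebesgue measure\<close>

text \<open>Finite sets are null: either \<open>B\<close> has measure 0 and the empty set serves, or
  \<open>B - {0}\<close> is infinite and has finite subsets of every size. Leaving out 0 keeps its
  membership free for a later choice.\<close>

lemma ex_finite_subset_card_floor:
  fixes B :: "real set"
  assumes "B \<in> lmeasurable" "M \<ge> 0"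
  shows "\<exists>C \<subseteq> B - {0}. finite C \<and> real (card C) \<le> M * measure lebesgue B \<and>
           M * measure lebesgue B \<le> real (card C) + 1"
proof -
  let ?k = "nat \<lfloor>M * measure lebesgue B\<rfloor>"
  have "\<exists>C \<subseteq> B - {0}. finite C \<and> card C = ?k"
  proof (cases "finite (B - {0})")
    case True
    then have "measure lebesgue B = 0"
      by (simp add: negligible_finite negligible_imp_measure0)
    then show ?thesis by (intro exI[of _ "{}"]) simp
  next
    case False
    then show ?thesis by (rule infinite_arbitrarily_large[THEN exE]) auto
  qed
  then obtain C where "C \<subseteq> B - {0}" "finite C" "card C = ?k" by blast
  moreover have "0 \<le> M * measure lebesgue B" using assms by simp
  then have "real ?k \<le> M * measure lebesgue B" "M * measure lebesgue B \<le> real ?k + 1"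
    by linarith+
  ultimately show ?thesis by (intro exI[of _ C]) auto
qed

lemma ex_finite_equidistributed:
  fixes F :: "real set set" and e :: real
  assumes "finite F" and F: "\<And>A. A \<in> F \<Longrightarrow> A \<subseteq> {0..<1} \<and> A \<in> sets lebesgue" and "e > 0"
  shows "\<exists>W. finite W \<and> W \<noteq> {} \<and> W \<subseteq> {0..<1} \<and> (0 \<in> W \<longleftrightarrow> b) \<and>
    (\<forall>A\<in>F. \<bar>real (card (A \<inter> W)) - measure lebesgue A * card W\<bar> < e * card W)"
proof -
  \<comment> \<open>The atoms \<open>B S\<close> of the algebra generated by \<open>F\<close>; the finite set gets about
    \<open>M * measure lebesgue (B S)\<close> points of each of them.\<close>
  define B where "B S = {x \<in> {0..<1}. \<forall>A\<in>F. x \<in> A \<longleftrightarrow> A \<in> S}" for S :: "real set set"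
  define m where "m = real (card (Pow F))"
  \<comment> \<open>The count in each set will be within \<open>m\<close> of its target, and
    replacing \<open>M\<close> by \<open>card W\<close> costs another \<open>m\<close>. This
    \<open>M\<close> makes \<open>card W \<ge> M - m > 2 * m / e\<close>, so the total error is
    below \<open>e * card W\<close>.\<close>
  define M where "M = m + 2 * m / e + 1"
  have m: "m \<ge> 1" using \<open>finite F\<close> by (simp add: m_def card_Pow)
  have M: "M \<ge> 0" using m \<open>e > 0\<close> by (simp add: M_def)
  have B_eq: "B S = {0..<1} \<inter> (\<Inter>A\<in>F. if A \<in> S then A else - A)" for S
  proof -
    have "x \<in> (if A \<in> S then A else - A) \<longleftrightarrow> (x \<in> A \<longleftrightarrow> A \<in> S)" for x A by simp
    then show ?thesis unfolding B_def by blast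
  qed
  have B_sets: "B S \<in> sets lebesgue" for S
  proof -
    have "(\<Inter>A\<in>F. if A \<in> S then A else - A) \<in> sets lebesgue"
    proof (cases "F = {}")
      case False
      have "(if A \<in> S then A else - A) \<in> sets lebesgue" if "A \<in> F" for A
        using F[OF that] by (simp add: Compl_in_sets_lebesgue)
      then show ?thesis using \<open>finite F\<close> False by (intro sets.finite_INT)
    qed simp
    then show ?thesis unfolding B_eq by (intro sets.Int) auto
  qed
  have I: "{0..<1::real} \<in> lmeasurable" by (simp add: lmeasurable_iff_integrable)
  have B: "B S \<in> lmeasurable" for S
    by (rule fmeasurableI2[OF I]) (auto simp: B_sets, auto simp: B_def)
  have disj: "B S \<inter> B T = {}" if "S \<subseteq> F" "T \<subseteq> F" "S \<noteq> T" for S T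
    using that by (auto simp: B_def)
  obtain C where C: "\<And>S. C S \<subseteq> B S - {0}" "\<And>S. finite (C S)"
    "\<And>S. real (card (C S)) \<le> M * measure lebesgue (B S)"
    "\<And>S. M * measure lebesgue (B S) \<le> real (card (C S)) + 1"
    using ex_finite_subset_card_floor[OF B M] by metis
  \<comment> \<open>No \<open>C S\<close> contains 0, so \<open>Z\<close> alone decides whether 0
    belongs to \<open>W\<close>.\<close>
  define Z :: "real set" where "Z = (if b then {0} else {})"
  define W where "W = (\<Union>S\<in>Pow F. C S) \<union> Z"
  \<comment> \<open>Rounding down loses at most one point per atom, hence at most \<open>m\<close>;
    the point of \<open>Z\<close> adds at most one, which \<open>m \<ge> 1\<close> covers.\<close>
  have bounds: "\<bar>real (card (U \<inter> W)) - M * measure lebesgue U\<bar> \<le> m"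
    if T: "T \<subseteq> Pow F" and U: "U = (\<Union>S\<in>T. B S)" for T U
  proof -
    have fT: "finite T" using T \<open>finite F\<close> by (meson finite_Pow_iff finite_subset)
    have "pairwise (\<lambda>S S'. disjnt (B S) (B S')) T"
      unfolding pairwise_def disjnt_def using T disj by blast
    then have "measure lebesgue U = (\<Sum>S\<in>T. measure lebesgue (B S))"
      unfolding U using fT B by (intro measure_UNION')
    then have mU: "M * measure lebesgue U = (\<Sum>S\<in>T. M * measure lebesgue (B S))"
      by (simp add: sum_distrib_left)
    have UW: "U \<inter> W = (\<Union>S\<in>T. C S) \<union> (U \<inter> Z)"
    proof (intro equalityI subsetI)
      fix x assume "x \<in> U \<inter> W"
      then obtain S where S: "S \<in> T" "x \<in> B S" and x: "x \<in> U" "x \<in> W" using U by blast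
      from x(2) consider "x \<in> Z" | S' where "S' \<subseteq> F" "x \<in> C S'" unfolding W_def by blast
      then show "x \<in> (\<Union>S\<in>T. C S) \<union> (U \<inter> Z)"
      proof cases
        case (2 S')
        then have "x \<in> B S'" using C(1)[of S'] by blast
        then have "S' = S" using disj[of S S'] S T 2(1) by blast
        then show ?thesis using 2(2) S(1) by blast
      qed (use x in blast)
    next
      fix x assume "x \<in> (\<Union>S\<in>T. C S) \<union> (U \<inter> Z)"
      then consider S where "S \<in> T" "x \<in> C S" | "x \<in> U" "x \<in> Z" by blast
      then show "x \<in> U \<inter> W"
      proof cases
        case (1 S)
        then show ?thesis using C(1)[of S] T unfolding U W_def by blast
      qed (simp add: W_def)
    qed
    have "card (\<Union>S\<in>T. C S) = (\<Sum>S\<in>T. card (C S))"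
    proof (rule card_UN_disjoint[OF fT])
      show "\<forall>S\<in>T. \<forall>S'\<in>T. S \<noteq> S' \<longrightarrow> C S \<inter> C S' = {}"
      proof (intro ballI impI)
        fix S S' assume "S \<in> T" "S' \<in> T" "S \<noteq> S'"
        then show "C S \<inter> C S' = {}" using disj[of S S'] C(1)[of S] C(1)[of S'] T by blast
      qed
    qed (use C(2) in blast)
    moreover have "card (U \<inter> W) = card (\<Union>S\<in>T. C S) + card (U \<inter> Z)"
      unfolding UW using fT C(1,2) by (intro card_Un_disjoint) (auto simp: Z_def)
    ultimately have cW: "real (card (U \<inter> W)) = (\<Sum>S\<in>T. real (card (C S))) + real (card (U \<inter> Z))"
      by simp
    have "card (U \<inter> Z) \<le> 1" unfolding Z_def by (auto simp: card_insert_if Int_insert_right)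
    then have "real (card (U \<inter> Z)) \<le> 1" by simp
    moreover have "(\<Sum>S\<in>T. real (card (C S))) \<le> M * measure lebesgue U"
      unfolding mU by (intro sum_mono C)
    moreover have "M * measure lebesgue U \<le> (\<Sum>S\<in>T. real (card (C S)) + 1)"
      unfolding mU by (intro sum_mono C)
    moreover have "card T \<le> card (Pow F)" using T \<open>finite F\<close> by (intro card_mono) auto
    then have "real (card T) \<le> m" by (simp add: m_def)
    ultimately show ?thesis using cW m by (simp add: sum.distrib abs_le_iff)
  qed
  have "B S \<subseteq> {0..<1}" for S unfolding B_def by blast
  then have "C S \<subseteq> {0..<1}" for S using C(1)[of S] by blast
  then have "(\<Union>S\<in>Pow F. C S) \<subseteq> {0..<1}" by blast
  moreover have "Z \<subseteq> {0..<1}" by (simp add: Z_def)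
  ultimately have Wsub: "W \<subseteq> {0..<1}" by (simp add: W_def)
  then have IW: "{0..<1} \<inter> W = W" by blast
  have "{0..<1} = (\<Union>S\<in>Pow F. B S)"
  proof (intro equalityI subsetI)
    fix x :: real assume "x \<in> {0..<1}"
    then have "x \<in> B {A \<in> F. x \<in> A}" by (auto simp: B_def)
    then show "x \<in> (\<Union>S\<in>Pow F. B S)" by (rule UN_I[rotated]) auto
  next
    fix x assume "x \<in> (\<Union>S\<in>Pow F. B S)"
    then show "x \<in> {0..<1}" unfolding B_def by blast
  qed
  \<comment> \<open>The whole interval has measure 1, so the bound compares \<open>card W\<close>
    with \<open>M\<close> itself.\<close>
  from bounds[OF order_refl this] have cardW: "\<bar>real (card W) - M\<bar> \<le> m" by (simp add: IW)
  have big: "2 * m < e * card W"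
  proof -
    have "2 * m / e < card W" using cardW by (simp add: M_def abs_le_iff)
    then show ?thesis using \<open>e > 0\<close> by (simp add: field_simps)
  qed
  have "\<bar>real (card (A \<inter> W)) - measure lebesgue A * card W\<bar> < e * card W" if "A \<in> F" for A
  proof -
    let ?\<mu> = "measure lebesgue A"
    have "A = (\<Union>S\<in>{S \<in> Pow F. A \<in> S}. B S)"
    proof (intro equalityI subsetI)
      fix x assume x: "x \<in> A"
      then have "x \<in> B {A \<in> F. x \<in> A}" using F[OF that] by (auto simp: B_def)
      then show "x \<in> (\<Union>S\<in>{S \<in> Pow F. A \<in> S}. B S)"
        by (rule UN_I[rotated]) (use x that in auto)
    next
      fix x assume "x \<in> (\<Union>S\<in>{S \<in> Pow F. A \<in> S}. B S)"
      then show "x \<in> A" using that unfolding B_def by blast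
    qed
    from bounds[OF _ this] have 1: "\<bar>real (card (A \<inter> W)) - M * ?\<mu>\<bar> \<le> m" by blast
    have "?\<mu> \<le> measure lebesgue {0..<1::real}"
      using F[OF that] I by (intro measure_mono_fmeasurable) auto
    then have "?\<mu> \<le> 1" by simp
    then have "?\<mu> * \<bar>real (card W) - M\<bar> \<le> 1 * m"
      using cardW by (intro mult_mono) auto
    then have 2: "\<bar>M * ?\<mu> - ?\<mu> * card W\<bar> \<le> m"
      by (simp add: abs_mult abs_minus_commute flip: right_diff_distrib' mult.commute[of _ M])
    from 1 2 big show ?thesis by linarith
  qed
  moreover have "finite W" using \<open>finite F\<close> C(2) by (simp add: W_def Z_def)
  moreover have "W \<noteq> {}" using big m by auto
  moreover have "0 \<in> W \<longleftrightarrow> b" using C(1) by (auto simp: W_def Z_def)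
  ultimately show ?thesis using Wsub by blast
qed

text \<open>Clipping the neighbourhood to the unit interval leaves an open interval of positive
  length, even at the endpoints 0 and 1.\<close>

lemma measure_lebesgue_near_unit_point_pos:
  fixes r d :: real
  assumes "r \<in> {0..1}" "d > 0"
  shows "measure lebesgue ({r - d<..<r + d} \<inter> {0..<1}) > 0"
proof -
  let ?l = "max (r - d) 0" and ?u = "min (r + d) 1"
  have "?l < ?u" using assms by auto
  moreover have "measure lebesgue {?l<..<?u} \<le> measure lebesgue ({r - d<..<r + d} \<inter> {0..<1})"
  proof (rule measure_mono_fmeasurable)
    show "{r - d<..<r + d} \<inter> {0..<1} \<in> lmeasurable"
      by (intro bounded_set_imp_lmeasurable) auto
  qed auto
  moreover have "measure lebesgue {?l<..<?u} = ?u - ?l" using \<open>?l < ?u\<close> by simp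
  ultimately show ?thesis by linarith
qed

section \<open>Hyperfinite models of the spinner\<close>

text \<open>The error is scaled by the cardinality instead of dividing by it; the strict inequality
  excludes codes of the empty set.\<close>

definition equidistributed_codes :: "real set \<Rightarrow> real \<Rightarrow> real set" where
  "equidistributed_codes A e =
     {r. \<bar>real (card (A \<inter> decode r)) - measure lebesgue A * card (decode r)\<bar> < e * card (decode r)}"

definition unit_codes :: "bool \<Rightarrow> real set" where
  "unit_codes b = {r. decode r \<noteq> {} \<and> decode r \<subseteq> {0..<1} \<and> (0 \<in> decode r \<longleftrightarrow> b)}"

definition spinner_code :: "('h, 'v, 'w) nsext \<Rightarrow> bool \<Rightarrow> 'h \<Rightarrow> bool" where
  "spinner_code N b h \<longleftrightarrow> h \<in> star_set N (unit_codes b) \<and>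
     (\<forall>A e. A \<subseteq> {0..<1} \<and> A \<in> sets lebesgue \<and> 0 < e \<longrightarrow> h \<in> star_set N (equidistributed_codes A e))"

section \<open>Codes of hyperfinite sets that approximate Lebesgue measure\<close>

context nsext
begin

lemma ex_spinner_code:
  assumes "saturated N"
  shows "\<exists>h. spinner_code N b h"
proof -
  define I where "I = {(A, e). A \<subseteq> {0..<1::real} \<and> A \<in> sets lebesgue \<and> 0 < (e::real)}"
  define \<K> where "\<K> = insert (unit_codes b) (case_prod equidistributed_codes ` I)"
  let ?X = "\<lambda>K. star N (obj1 (std N) K)"
  \<comment> \<open>The conditions are sets of reals, so there are at most as many as the assumed
    saturation handles.\<close>
  have "?X ` \<K> \<lesssim> Pow (UNIV :: real set)"
    using lepoll_trans[OF image_lepoll subset_imp_lepoll] by (metis Pow_UNIV subset_UNIV)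
  moreover have "internal N X \<and> X \<notin> range (atom (nst N))" if "X \<in> ?X ` \<K>" for X
    using that internal_set_star_set star_obj1_not_atom by (auto simp: internal_set_def star_obj1)
  moreover have "(\<Inter>X\<in>G. elts (nst N) X) \<noteq> {}" if G: "G \<subseteq> ?X ` \<K>" "finite G" for G
  proof -
    obtain \<G> where \<G>: "\<G> \<subseteq> \<K>" "finite \<G>" "G = ?X ` \<G>"
      using finite_subset_image[OF G(2,1)] by blast
    have "\<G> - {unit_codes b} \<subseteq> case_prod equidistributed_codes ` I" using \<G>(1) by (auto simp: \<K>_def)
    then obtain J where J: "J \<subseteq> I" "finite J" "\<G> - {unit_codes b} = case_prod equidistributed_codes ` J"
      using finite_subset_image[of "\<G> - {unit_codes b}"] \<G>(2) by (metis finite_Diff)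
    \<comment> \<open>The smallest tolerance implies all the others; 1 is inserted so that the
      minimum makes sense when \<open>J\<close> is empty.\<close>
    define e where "e = Min (insert 1 (snd ` J))"
    have e: "e > 0" "\<And>A d. (A, d) \<in> J \<Longrightarrow> e \<le> d"
      using J(1,2) by (auto simp: e_def I_def intro!: Min_le image_eqI)
    have J_sets: "A \<subseteq> {0..<1} \<and> A \<in> sets lebesgue" if A: "A \<in> fst ` J" for A
    proof -
      from A obtain d where "(A, d) \<in> J" by force
      then have "(A, d) \<in> I" using J(1) by blast
      then show ?thesis by (simp add: I_def)
    qed
    from ex_finite_equidistributed[where F = "fst ` J" and b = b, OF _ J_sets e(1)] J(2)
    obtain W where W: "finite W" "W \<noteq> {}" "W \<subseteq> {0..<1}" "0 \<in> W \<longleftrightarrow> b"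
      "\<And>A. A \<in> fst ` J \<Longrightarrow> \<bar>real (card (A \<inter> W)) - measure lebesgue A * card W\<bar> < e * card W"
      by blast
    obtain r where r: "decode r = W" using ex_decode[OF W(1)] by blast
    have "r \<in> K" if "K \<in> \<G>" for K
    proof (cases "K = unit_codes b")
      case True
      then show ?thesis using W r by (simp add: unit_codes_def)
    next
      case False
      then have "K \<in> case_prod equidistributed_codes ` J" using J(3) that by blast
      then obtain A d where Ad: "(A, d) \<in> J" "K = equidistributed_codes A d" by auto
      have "\<bar>real (card (A \<inter> W)) - measure lebesgue A * card W\<bar> < e * card W"
        using W(5)[of A] Ad(1) by force
      also have "\<dots> \<le> d * card W" using e(2)[OF Ad(1)] by (intro mult_right_mono) auto
      finally show ?thesis using Ad(2) r by (simp add: equidistributed_codes_def)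
    qed
    \<comment> \<open>For finitely many conditions a real code suffices, and its image lies in all
      the extensions.\<close>
    then have "atom (nst N) (hyper N r) \<in> (\<Inter>X\<in>G. elts (nst N) X)"
      unfolding \<G>(3) by auto
    then show ?thesis by blast
  qed
  ultimately have "(\<Inter>X\<in>?X ` \<K>. elts (nst N) X) \<noteq> {}"
    using assms unfolding saturated_def by blast
  then obtain x where x: "\<And>K. K \<in> \<K> \<Longrightarrow> x \<in> atom (nst N) ` star_set N K" by auto
  then obtain h where "x = atom (nst N) h" unfolding \<K>_def by blast
  then have "\<And>K. K \<in> \<K> \<Longrightarrow> h \<in> star_set N K" using x by auto
  then have "spinner_code N b h" unfolding spinner_code_def \<K>_def I_def by blast
  then show ?thesis ..
qed

lemma spinner_code_hfin:
  assumes "spinner_code N b h"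
  shows hfin_nonempty: "hfin N h \<noteq> {}"
    and hfin_unit: "hfin N h \<subseteq> star_set N {0..<1}"
    and zero_in_hfin: "0 \<in> hfin N h \<longleftrightarrow> b"
proof -
  have h: "h \<in> star_set N (unit_codes b)" using assms by (simp add: spinner_code_def)
  \<comment> \<open>The truth value \<open>b\<close> is not an object of the superstructure, so it
    selects the formula instead.\<close>
  have "sat (nst N)
      (\<lambda>i. star N ([obj1 (std N) UNIV, obj2 (std N) {(x, r). x \<in> decode r},
         obj1 (std N) (unit_codes b), obj1 (std N) {0..<1}, atom (std N) 0] ! i))
      (BAll 5 2 (Conj (BEx 6 0 (Mem2 6 5 1)) (Conj (BAll 6 0 (Imp (Mem2 6 5 1) (Mem 6 3)))
         (if b then Mem2 4 5 1 else Neg (Mem2 4 5 1)))))"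
    unfolding transfer by (cases b) (auto simp: unit_codes_def)
  then show "hfin N h \<noteq> {}" "hfin N h \<subseteq> star_set N {0..<1}" "0 \<in> hfin N h \<longleftrightarrow> b"
    using h by (cases b; auto simp: hfin_def)+
qed

text \<open>For each real \<open>e > 0\<close> the code lies in the extension of a standard set on
  which the ratio of cardinalities is within \<open>e\<close> of the measure. The ratio enters as
  \<open>p\<close> with \<open>m = p * k\<close>, since multiplication is available as a
  relation.\<close>

lemma spinner_code_ratio:
  assumes "spinner_code N b h" "A \<subseteq> {0..<1}" "A \<in> sets lebesgue"
    and g: "star_set N A \<inter> hfin N h = hfin N g"
  shows "inf_close N (hcard N (hfin N g) / hcard N (hfin N h)) (hyper N (measure lebesgue A))"
  unfolding inf_close_hyper_iff
proof (intro allI impI)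
  fix e :: real assume "e > 0"
  let ?\<mu> = "measure lebesgue A"
  obtain G H where GH: "hcard_of_code N g G" "hcard_of_code N h H"
    using ex_hcard_of_code by meson
  have h: "h \<in> star_set N (equidistributed_codes A e)"
    using assms \<open>e > 0\<close> by (simp add: spinner_code_def)
  have standard: "\<forall>r\<in>equidistributed_codes A e. \<forall>s. (\<forall>x. x \<in> decode s \<longleftrightarrow> x \<in> A \<and> x \<in> decode r) \<longrightarrow>
      (\<forall>m k p. m = real (card (decode s)) \<and> k = real (card (decode r)) \<and> m = p * k \<longrightarrow>
         ?\<mu> - e < p \<and> p < ?\<mu> + e)"
  proof (intro ballI allI impI)
    fix r s m k p
    assume r: "r \<in> equidistributed_codes A e"
      and "\<forall>x. x \<in> decode s \<longleftrightarrow> x \<in> A \<and> x \<in> decode r"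
      and mkp: "m = real (card (decode s)) \<and> k = real (card (decode r)) \<and> m = p * k"
    then have "decode s = A \<inter> decode r" by blast
    then have "\<bar>real (card (decode s)) - ?\<mu> * card (decode r)\<bar> < e * card (decode r)"
      using r by (simp add: equidistributed_codes_def)
    then have "\<bar>p * k - ?\<mu> * k\<bar> < e * k"
      using mkp by metis
    moreover have "k \<ge> 0" using mkp by simp
    ultimately have "\<bar>p - ?\<mu>\<bar> * k < e * k"
      by (simp add: abs_mult flip: left_diff_distrib)
    then have "\<bar>p - ?\<mu>\<bar> < e" using \<open>k \<ge> 0\<close> by (simp add: mult_less_cancel_right)
    then show "?\<mu> - e < p \<and> p < ?\<mu> + e" by linarith
  qed
  have "sat (nst N)
      (\<lambda>i. star N ([obj1 (std N) UNIV, obj2 (std N) {(x, r). x \<in> decode r},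
         obj2 (std N) {(r, n). n = real (card (decode r))}, obj1 (std N) A,
         obj1 (std N) (equidistributed_codes A e), obj3 (std N) {(x, y, z). z = x * y},
         obj2 (std N) {(x, y). x < y}, atom (std N) (?\<mu> - e), atom (std N) (?\<mu> + e)] ! i))
      (BAll 10 4 (BAll 11 0 (Imp (BAll 12 0 (Iff (Mem2 12 11 1) (Conj (Mem 12 3) (Mem2 12 10 1))))
         (BAll 13 0 (BAll 14 0 (BAll 15 0
            (Imp (Conj (Mem2 11 13 2) (Conj (Mem2 10 14 2) (Mem3 15 14 13 5)))
               (Conj (Mem2 7 15 6) (Mem2 15 8 6)))))))))"
    unfolding transfer
    by (rule iffD2[OF _ standard]) (simp add: eq_commute[of "real (card (decode s))" for s])
  then have "\<forall>r\<in>star_set N (equidistributed_codes A e).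
      \<forall>s. (\<forall>x. x \<in> hfin N s \<longleftrightarrow> x \<in> star_set N A \<and> x \<in> hfin N r) \<longrightarrow>
      (\<forall>m k p. hcard_of_code N s m \<and> hcard_of_code N r k \<and> m = p * k \<longrightarrow>
         hyper N (?\<mu> - e) < p \<and> p < hyper N (?\<mu> + e))"
    by (rule iffD1[rotated]) (simp add: hfin_def hcard_of_code_def)
  note this[rule_format, OF h, of g G H "G / H"]
  \<comment> \<open>This gives \<open>G = (G / H) * H\<close>, the instance of the product relation
    that is required.\<close>
  moreover have "H \<noteq> 0"
    using hcard_hfin_pos[OF hfin_nonempty[OF assms(1)]] hcard_hfin[OF GH(2)] by simp
  ultimately show "hyper N (?\<mu> - e) < hcard N (hfin N g) / hcard N (hfin N h) \<and>
      hcard N (hfin N g) / hcard N (hfin N h) < hyper N (?\<mu> + e)"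
    using g GH by (auto simp: hcard_hfin set_eq_iff)
qed

section \<open>The four hypotheses for coded sample spaces\<close>

lemma hprob_hfin:
  assumes "hfin N g \<subseteq> hfin N h"
  shows "hprob N (hfin N h) (hfin N g) = Some (hcard N (hfin N g) / hcard N (hfin N h))"
  using assms by (simp add: hprob_def hyperfinite_hfin)

lemma hprob_hfin_bounds:
  assumes "hfin N g \<subseteq> hfin N h"
  shows "0 \<le> hcard N (hfin N g) / hcard N (hfin N h)" "hcard N (hfin N g) / hcard N (hfin N h) \<le> 1"
proof -
  have nonneg: "0 \<le> hcard N (hfin N k)" for k
    using hcard_hfin_pos[of k] hcard_empty by (cases "hfin N k = {}") (auto simp: less_imp_le)
  then show "0 \<le> hcard N (hfin N g) / hcard N (hfin N h)" "hcard N (hfin N g) / hcard N (hfin N h) \<le> 1"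
    using divide_right_mono[OF hcard_hfin_mono[OF assms] nonneg[of h]] nonneg
    by (auto simp: divide_self_if split: if_splits)
qed

lemma Reg_hfin: "Reg N (hfin N h) (hprob N (hfin N h))"
  unfolding Reg_def
proof (intro allI impI)
  fix A assume A: "A \<subseteq> hfin N h" "internal_set N A \<and> A \<noteq> {}"
  then obtain g where g: "A = hfin N g" using internal_subset_hfin by blast
  have "hcard N (hfin N g) > 0" "hcard N (hfin N h) > 0"
    using A g by (auto intro!: hcard_hfin_pos)
  then show "\<exists>p. hprob N (hfin N h) A = Some p \<and> 0 < p"
    using hprob_hfin A g by auto
qed

lemma Tot_hfin: "Tot N (hfin N h) (hprob N (hfin N h))"
  unfolding Tot_def
proof (intro conjI allI impI)
  fix A assume "A \<subseteq> hfin N h" "internal_set N A"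
  then show "\<exists>p. hprob N (hfin N h) A = Some p \<and> 0 \<le> p \<and> p \<le> 1"
    using internal_subset_hfin[of A h] hprob_hfin hprob_hfin_bounds by blast
next
  fix A :: "real set"
  obtain g where "star_set N A \<inter> hfin N h = hfin N g" using star_set_Int_hfin by blast
  moreover from this have "hfin N g \<subseteq> hfin N h" by blast
  ultimately show "\<exists>p. hprob N (hfin N h) (star_set N A \<inter> hfin N h) = Some p \<and> 0 \<le> p \<and> p \<le> 1"
    using hprob_hfin hprob_hfin_bounds by simp
qed

text \<open>Chances are quotients of internal cardinalities, which are unique.\<close>

lemma Un_h_hprob: "Un_h N \<Omega> (hprob N \<Omega>)"
  unfolding Un_h_def hprob_def hyperfinite_def by (auto dest!: hcard_eqI)

lemma Co_hfin:
  assumes "spinner_code N b h"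
  shows "Co N (hfin N h) (hprob N (hfin N h))"
  unfolding Co_def
proof (intro allI impI)
  fix A assume A: "A \<subseteq> {0..<1::real}" "A \<in> sets lebesgue"
  obtain g where g: "star_set N A \<inter> hfin N h = hfin N g" using star_set_Int_hfin by blast
  moreover from this have "hfin N g \<subseteq> hfin N h" by blast
  ultimately show "\<exists>p. hprob N (hfin N h) (star_set N A \<inter> hfin N h) = Some p \<and>
      inf_close N p (hyper N (measure lebesgue A))"
    using hprob_hfin spinner_code_ratio[OF assms A g] by simp
qed

section \<open>The standard part of a coded sample space\<close>

lemma star_set_meets_hfin:
  assumes "spinner_code N b h" "A \<subseteq> {0..<1}" "A \<in> sets lebesgue" "measure lebesgue A > 0"
  shows "star_set N A \<inter> hfin N h \<noteq> {}"
proof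
  assume empty: "star_set N A \<inter> hfin N h = {}"
  obtain g where g: "star_set N A \<inter> hfin N h = hfin N g" using star_set_Int_hfin by blast
  \<comment> \<open>An empty intersection has ratio 0, which cannot be infinitely close to a
    positive real.\<close>
  from spinner_code_ratio[OF assms(1-3) g] have "inf_close N (hyper N 0) (hyper N (measure lebesgue A))"
    using empty g hcard_empty by simp
  moreover have "inf_close N (hyper N 0) (hyper N 0)"
    by (simp add: inf_close_def infinitesimal_def hyper_less_iff[of 0, simplified])
  ultimately show False using assms(4) inf_close_hyper_unique[of "hyper N 0" 0 "measure lebesgue A"]
    by simp
qed

lemma ex_inf_close_in_hfin:
  assumes "saturated N" "spinner_code N b h" and r: "r \<in> {0..1}"
  shows "\<exists>x\<in>hfin N h. inf_close N x (hyper N r)"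
proof -
  define B where "B n = {r - 1 / Suc n<..<r + 1 / Suc n} \<inter> {0..<1}" for n
  have B_mono: "B n \<subseteq> B m" if "m \<le> n" for m n
  proof -
    have "1 / Suc n \<le> 1 / real (Suc m)" using that by (intro divide_left_mono) auto
    then show ?thesis by (auto simp: B_def)
  qed
  have meets: "star_set N (B n) \<inter> hfin N h \<noteq> {}" for n
  proof (rule star_set_meets_hfin[OF assms(2)])
    show "measure lebesgue (B n) > 0"
      unfolding B_def by (rule measure_lebesgue_near_unit_point_pos[OF r]) simp
  qed (auto simp: B_def)
  let ?X = "\<lambda>n. obj1 (nst N) (star_set N (B n) \<inter> hfin N h)"
  have "range ?X \<lesssim> Pow (UNIV :: real set)"
  proof -
    have "range ?X \<lesssim> (UNIV :: nat set)" by (rule image_lepoll)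
    also have "(UNIV :: nat set) \<lesssim> Pow (UNIV :: real set)"
      unfolding lepoll_def by (intro exI[of _ "\<lambda>n. {real n}"]) (auto simp: inj_on_def)
    finally show ?thesis .
  qed
  moreover have "internal N X \<and> X \<notin> range (atom (nst N))" if X: "X \<in> range ?X" for X
  proof -
    obtain n where n: "X = ?X n" using X by blast
    obtain g where g: "star_set N (B n) \<inter> hfin N h = hfin N g" using star_set_Int_hfin by blast
    have "internal_set N (hfin N g)" unfolding hfin_def by (rule internal_section)
    then show ?thesis using n g nst.obj1_not_atom by (simp add: internal_set_def)
  qed
  moreover have "(\<Inter>X\<in>G. elts (nst N) X) \<noteq> {}" if G: "G \<subseteq> range ?X" "finite G" for G
  proof -
    obtain J where J: "finite J" "G = ?X ` J" using finite_subset_image[OF G(2,1)] by blast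
    \<comment> \<open>The neighbourhoods decrease, so a point for the largest index serves for all;
      0 is inserted for the case of empty \<open>J\<close>.\<close>
    obtain x where x: "x \<in> star_set N (B (Max (insert 0 J))) \<inter> hfin N h" using meets by blast
    have "x \<in> star_set N (B j)" if "j \<in> J" for j
      using x star_set_mono[OF B_mono[of j "Max (insert 0 J)"]] that J(1) by auto
    then have "atom (nst N) x \<in> (\<Inter>X\<in>G. elts (nst N) X)" using x J(2) by auto
    then show ?thesis by blast
  qed
  ultimately have "(\<Inter>X\<in>range ?X. elts (nst N) X) \<noteq> {}"
    using assms(1) unfolding saturated_def by blast
  then obtain y where y: "\<And>n. y \<in> atom (nst N) ` (star_set N (B n) \<inter> hfin N h)" by auto
  then obtain x where x: "y = atom (nst N) x" by blast
  have xB: "x \<in> star_set N (B n)" and xh: "x \<in> hfin N h" for n using y x by auto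
  have "inf_close N x (hyper N r)"
    unfolding inf_close_hyper_iff
  proof (intro allI impI)
    fix e :: real assume "e > 0"
    then obtain n where n: "1 / Suc n < e" using nat_approx_posE by metis
    have "B n \<subseteq> {r - e<..<r + e}" using n by (auto simp: B_def)
    then have "x \<in> {hyper N (r - e)<..<hyper N (r + e)}"
      using xB[of n] star_set_mono star_set_greaterThanLessThan_subset by blast
    then show "hyper N (r - e) < x \<and> x < hyper N (r + e)" by simp
  qed
  then show ?thesis using xh by blast
qed

lemma spinner_sample_space_hfin:
  assumes "saturated N" "spinner_code N b h"
  shows "spinner_sample_space N (hfin N h)"
  unfolding spinner_sample_space_def
proof (intro conjI equalityI subsetI)
  fix r assume "r \<in> st N ` hfin N h"
  then obtain x where x: "x \<in> star_set N {0..<1}" "r = st N x" using hfin_unit[OF assms(2)] by blast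
  \<comment> \<open>All points lie strictly below 1 but may be infinitely close to it, hence the
    closed interval.\<close>
  then have "hyper N 0 \<le> x" "x \<le> hyper N 1"
    using star_set_atLeastLessThan_subset[of 0 1] by (auto simp: less_imp_le)
  then show "r \<in> {0..1}" using st_in_interval[of 0 x 1] x(2) by simp
next
  fix r :: real assume "r \<in> {0..1}"
  from ex_inf_close_in_hfin[OF assms this] show "r \<in> st N ` hfin N h"
    using st_eqI by blast
qed (use hyperfinite_hfin hfin_unit[OF assms(2)] in auto)

end

theorem corollary5p6:
  fixes N :: "('h :: linordered_field, 'v, 'w) nsext"
  assumes "nonstandard_extension N" and "saturated N"
  shows "\<exists>\<Omega> \<Omega>'. \<Omega> \<noteq> \<Omega>' \<and>
    spinner_sample_space N \<Omega> \<and> spinner_sample_space N \<Omega>' \<and>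
    Reg N \<Omega> (hprob N \<Omega>) \<and> Tot N \<Omega> (hprob N \<Omega>) \<and>
    Un_h N \<Omega> (hprob N \<Omega>) \<and> Co N \<Omega> (hprob N \<Omega>) \<and>
    Reg N \<Omega>' (hprob N \<Omega>') \<and> Tot N \<Omega>' (hprob N \<Omega>') \<and>
    Un_h N \<Omega>' (hprob N \<Omega>') \<and> Co N \<Omega>' (hprob N \<Omega>')"
proof -
  interpret nsext N by unfold_locales (rule assms(1))
  obtain g h where g: "spinner_code N True g" and h: "spinner_code N False h"
    using ex_spinner_code[OF assms(2)] by meson
  \<comment> \<open>The point 0 separates the two sample spaces.\<close>
  have "hfin N g \<noteq> hfin N h"
    using zero_in_hfin[OF g] zero_in_hfin[OF h] by blast
  then show ?thesis
    using spinner_sample_space_hfin[OF assms(2) g] spinner_sample_space_hfin[OF assms(2) h]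
      Reg_hfin Tot_hfin Un_h_hprob Co_hfin[OF g] Co_hfin[OF h] by blast
qed

end
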